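(* Let $\big(\{\mathcal{D}_s\}_{s\in S},\{\beta_s\}_{s\in S},\{\omega(s,t)\}_{s,t\in S}\big)$ be a twisted action of an inverse semigroup $S$ on a $C^*$-algebra $B$. Let $\mathcal{B}=\{(b,s)\in B\times S: b\in\mathcal{D}_s\}$, with the obvious projection $\mathcal{B}\to S$, write $b\delta_s$ for $(b,s)\in\mathcal{B}$, and let $\mathcal{B}_s=\{b\delta_s: b\in\mathcal{D}_s\}$ carry the linear structure and norm inherited from $\mathcal{D}_s$. Define $$(a\delta_s)\cdot(b\delta_t)=\beta_s\big(\beta_s^{-1}(a)b\big)\omega(s,t)\delta_{st},\qquad (a\delta_s)^*=\beta_s^{-1}(a^* )\omega(s^*,s)^*\delta_{s^*}$$ for $a\in\mathcal{D}_s$, $b\in\mathcal{D}_t$, $s,t\in S$, and, whenever $s\le t$, $$j_{t,s}:\mathcal{B}_s\to\mathcal{B}_t,\qquad j_{t,s}(a\delta_s)=a\,\omega(t,s^*s)^*\delta_t .$$ Then $\mathcal{B}$ with these operations and inclusion maps is a saturated, regular Fell bundle over $S$.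
   Context: $E(S)$ is the set of idempotents of $S$, $s^*$ the inverse of $s$, and $s\le t$ the natural partial order ($s=ts^*s$). **Twisted action.** A twisted action of $S$ on $B$ consists of closed two-sided ideals $\mathcal{D}_s$ of $B$ ($s\in S$) whose linear span is dense in $B$, $*$-isomorphisms $\beta_s:\mathcal{D}_{s^*}\to\mathcal{D}_s$ and unitary multipliers $\omega(s,t)\in\mathcal{U}\mathcal{M}(\mathcal{D}_{st})$ such that for all $r,s,t\in S$, $e,f\in E(S)$: (i) $\beta_r\circ\beta_s=\mathrm{Ad}_{\omega(r,s)}\circ\beta_{rs}$ (as partially defined maps on their natural domains; $\mathrm{Ad}_w(x)=wxw^*$); (ii) $\beta_r(x\omega(s,t))\omega(r,st)=\beta_r(x)\omega(r,s)\omega(rs,t)$ for $x\in\mathcal{D}_{r^*}\cap\mathcal{D}_{st}$; (iii) $\omega(e,f)=1_{ef}$ and $\omega(r,r^*r)=\omega(rr^*,r)=1_r$, where $1_r$ is the unit of $\mathcal{M}(\mathcal{D}_r)$; (iv) $\omega(s^*,e)\omega(s^*e,s)x=\omega(s^*,s)x$ for $x\in\mathcal{D}_{s^*es}$. **Fell bundle.** A Fell bundle over $S$ is a collection $\mathcal{A}=\{\mathcal{A}_s\}_{s\in S}$ of Banach spaces (also viewed as their disjoint union) with a multiplication, an involution, and isometric linear maps $j_{t,s}:\mathcal{A}_s\to\mathcal{A}_t$ for $s\le t$, such that: (i) $\mathcal{A}_s\cdot\mathcal{A}_t\subseteq\mathcal{A}_{st}$, bilinearly; (ii) multiplication is associative;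 (iii) $\|ab\|\le\|a\|\|b\|$; (iv) $\mathcal{A}_s^*\subseteq\mathcal{A}_{s^*}$, conjugate-linearly; (v) $(a^* )^*=a$, $\|a^*\|=\|a\|$, $(ab)^*=b^*a^*$; (vi) $\|a^*a\|=\|a\|^2$ and $a^*a$ is a positive element of the $C^*$-algebra $\mathcal{A}_{s^*s}$ for $a\in\mathcal{A}_s$; (vii) $j_{t,r}=j_{t,s}\circ j_{s,r}$ if $r\le s\le t$; (viii) $j_{t,s}(a)j_{v,u}(b)=j_{tv,su}(ab)$ if $s\le t$, $u\le v$, $a\in\mathcal{A}_s$, $b\in\mathcal{A}_u$; (ix) $j_{t,s}(a)^*=j_{t^*,s^*}(a^* )$ if $s\le t$, $a\in\mathcal{A}_s$. It is saturated if $\mathcal{A}_s\cdot\mathcal{A}_t$ spans a dense subspace of $\mathcal{A}_{st}$ for all $s,t$. **Regular.** A saturated Fell bundle is regular if for every $s$ the fiber $\mathcal{A}_s$, viewed as an imprimitivity Hilbert $\mathcal{A}_{ss^*},\mathcal{A}_{s^*s}$-bimodule (inner products $ab^*$ and $a^*b$), is regular, i.e. there is an adjointable operator $u:\mathcal{A}_{s^*s}\to\mathcal{A}_s$ of right Hilbert $\mathcal{A}_{s^*s}$-modules with $u^*u=1$ and $uu^*=1$. *)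

theory Defs
  imports "HOL-Analysis.Analysis"
begin

section \<open>Inverse semigroups\<close>

class inverse_semigroup = semigroup_mult +
  fixes sinv :: "'a \<Rightarrow> 'a"  ("_\<^sup>\<star>" [1000] 999)
  assumes mult_sinv_mult: "s * s\<^sup>\<star> * s = s"
    and sinv_mult_sinv: "s\<^sup>\<star> * s * s\<^sup>\<star> = s\<^sup>\<star>"
    and sinv_unique: "s * t * s = s \<Longrightarrow> t * s * t = t \<Longrightarrow> t = s\<^sup>\<star>"

definition idempotents :: "'s::inverse_semigroup set" where
  "idempotents = {e. e * e = e}"

definition natural_le :: "'s::inverse_semigroup \<Rightarrow> 's \<Rightarrow> bool"  (infix "\<preceq>" 50) where
  "s \<preceq> t \<longleftrightarrow> s = t * s\<^sup>\<star> * s"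


section \<open>C*-algebras\<close>

text \<open>Complex C*-algebras, not assumed to be unital. The real structure inherited from
  \<^class>\<open>real_normed_algebra\<close> is the restriction of the complex one.\<close>

class cstar_algebra = real_normed_algebra + banach +
  fixes scaleC :: "complex \<Rightarrow> 'a \<Rightarrow> 'a"  (infixr "*\<^sub>C" 75)
    and star :: "'a \<Rightarrow> 'a"  ("_\<^sup>\<dagger>" [1000] 999)
  assumes scaleC_add_right: "c *\<^sub>C (x + y) = c *\<^sub>C x + c *\<^sub>C y"
    and scaleC_add_left: "(c + d) *\<^sub>C x = c *\<^sub>C x + d *\<^sub>C x"
    and scaleC_scaleC: "c *\<^sub>C d *\<^sub>C x = (c * d) *\<^sub>C x"
    and scaleR_scaleC: "scaleR r x = complex_of_real r *\<^sub>C x"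
    and mult_scaleC_left: "(c *\<^sub>C x) * y = c *\<^sub>C (x * y)"
    and mult_scaleC_right: "x * (c *\<^sub>C y) = c *\<^sub>C (x * y)"
    and norm_scaleC: "norm (c *\<^sub>C x) = cmod c * norm x"
    and star_add: "(x + y)\<^sup>\<dagger> = x\<^sup>\<dagger> + y\<^sup>\<dagger>"
    and star_scaleC: "(c *\<^sub>C x)\<^sup>\<dagger> = cnj c *\<^sub>C x\<^sup>\<dagger>"
    and star_mult: "(x * y)\<^sup>\<dagger> = y\<^sup>\<dagger> * x\<^sup>\<dagger>"
    and star_star: "(x\<^sup>\<dagger>)\<^sup>\<dagger> = x"
    and cstar_identity: "norm (x\<^sup>\<dagger> * x) = (norm x)\<^sup>2"

global_interpretation complex_space: vector_space "scaleC :: complex \<Rightarrow> 'b \<Rightarrow> 'b::cstar_algebra"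
proof
  fix x :: 'b
  show "1 *\<^sub>C x = x"
    using scaleR_scaleC[of 1 x] by simp
qed (simp_all add: scaleC_add_right scaleC_add_left scaleC_scaleC)

definition closed_ideal :: "'b::cstar_algebra set \<Rightarrow> bool" where
  "closed_ideal I \<longleftrightarrow> closed I \<and> complex_space.subspace I \<and>
     (\<forall>x\<in>I. \<forall>b. b * x \<in> I \<and> x * b \<in> I)"

definition linear_on :: "'b::cstar_algebra set \<Rightarrow> ('b \<Rightarrow> 'b) \<Rightarrow> bool" where
  "linear_on I f \<longleftrightarrow>
     (\<forall>x\<in>I. \<forall>y\<in>I. f (x + y) = f x + f y) \<and> (\<forall>c. \<forall>x\<in>I. f (c *\<^sub>C x) = c *\<^sub>C f x)"

definition star_isomorphism ::
  "'b::cstar_algebra set \<Rightarrow> 'b set \<Rightarrow> ('b \<Rightarrow> 'b) \<Rightarrow> bool" where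
  "star_isomorphism I J f \<longleftrightarrow> bij_betw f I J \<and> linear_on I f \<and>
     (\<forall>x\<in>I. \<forall>y\<in>I. f (x * y) = f x * f y) \<and> (\<forall>x\<in>I. f (x\<^sup>\<dagger>) = (f x)\<^sup>\<dagger>)"


section \<open>Multiplier algebras\<close>

text \<open>The multiplier algebra of a closed ideal \<open>I\<close> is its algebra of double centralizers: a
  multiplier \<open>w\<close> is the pair \<open>(L, R)\<close> of the maps \<open>x \<mapsto> w x\<close> and \<open>x \<mapsto> x w\<close> on \<open>I\<close>. The
  components are required to be extensional (undefined outside \<open>I\<close>) so that equality of pairs
  is equality of multipliers of \<open>I\<close>.\<close>

type_synonym 'b multiplier = "('b \<Rightarrow> 'b) \<times> ('b \<Rightarrow> 'b)"

abbreviation multiplier_left :: "'b multiplier \<Rightarrow> 'b \<Rightarrow> 'b"  (infixr "\<rhd>" 72) where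
  "w \<rhd> x \<equiv> fst w x"

abbreviation multiplier_right :: "'b \<Rightarrow> 'b multiplier \<Rightarrow> 'b"  (infixl "\<lhd>" 72) where
  "x \<lhd> w \<equiv> snd w x"

definition multipliers :: "'b::cstar_algebra set \<Rightarrow> 'b multiplier set" where
  "multipliers I = {(L, R).
     L \<in> I \<rightarrow>\<^sub>E I \<and> linear_on I L \<and> (\<exists>K. \<forall>x\<in>I. norm (L x) \<le> K * norm x) \<and>
     R \<in> I \<rightarrow>\<^sub>E I \<and> linear_on I R \<and> (\<exists>K. \<forall>x\<in>I. norm (R x) \<le> K * norm x) \<and>
     (\<forall>x\<in>I. \<forall>y\<in>I. L (x * y) = L x * y \<and> R (x * y) = x * R y \<and> R x * y = x * L y)}"

definition multiplier_one :: "'b set \<Rightarrow> 'b multiplier" where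
  "multiplier_one I = (\<lambda>x\<in>I. x, \<lambda>x\<in>I. x)"

definition multiplier_mult :: "'b set \<Rightarrow> 'b multiplier \<Rightarrow> 'b multiplier \<Rightarrow> 'b multiplier" where
  "multiplier_mult I v w = (\<lambda>x\<in>I. v \<rhd> (w \<rhd> x), \<lambda>x\<in>I. (x \<lhd> v) \<lhd> w)"

definition multiplier_star :: "'b::cstar_algebra set \<Rightarrow> 'b multiplier \<Rightarrow> 'b multiplier" where
  "multiplier_star I w = (\<lambda>x\<in>I. (x\<^sup>\<dagger> \<lhd> w)\<^sup>\<dagger>, \<lambda>x\<in>I. (w \<rhd> x\<^sup>\<dagger>)\<^sup>\<dagger>)"

definition unitary_multipliers :: "'b::cstar_algebra set \<Rightarrow> 'b multiplier set" where
  "unitary_multipliers I = {w \<in> multipliers I.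
     multiplier_mult I (multiplier_star I w) w = multiplier_one I \<and>
     multiplier_mult I w (multiplier_star I w) = multiplier_one I}"

definition Ad :: "'b::cstar_algebra set \<Rightarrow> 'b multiplier \<Rightarrow> 'b \<Rightarrow> 'b" where
  "Ad I w x = (w \<rhd> x) \<lhd> multiplier_star I w"


section \<open>Twisted actions\<close>

text \<open>The maps \<open>\<beta> s\<close> are total functions of which only the restriction to \<open>D (s\<^sup>\<star>)\<close> matters; the
  composition law is an equality of partial maps, so it includes equality of the natural domains.\<close>

locale twisted_action =
  fixes D :: "'s::inverse_semigroup \<Rightarrow> 'b::cstar_algebra set"
    and \<beta> :: "'s \<Rightarrow> 'b \<Rightarrow> 'b"
    and \<omega> :: "'s \<Rightarrow> 's \<Rightarrow> 'b multiplier"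
  assumes ideal: "closed_ideal (D s)"
    and dense: "closure (complex_space.span (\<Union>s. D s)) = UNIV"
    and iso: "star_isomorphism (D (s\<^sup>\<star>)) (D s) (\<beta> s)"
    and unitary: "\<omega> s t \<in> unitary_multipliers (D (s * t))"
    and comp:
      "((Some \<circ> \<beta> r) |` D (r\<^sup>\<star>)) \<circ>\<^sub>m ((Some \<circ> \<beta> s) |` D (s\<^sup>\<star>)) =
       ((Some \<circ> Ad (D (r * s)) (\<omega> r s)) |` D (r * s)) \<circ>\<^sub>m ((Some \<circ> \<beta> (r * s)) |` D ((r * s)\<^sup>\<star>))"
    and cocycle:
      "x \<in> D (r\<^sup>\<star>) \<inter> D (s * t) \<Longrightarrow>
       \<beta> r (x \<lhd> \<omega> s t) \<lhd> \<omega> r (s * t) = \<beta> r x \<lhd> \<omega> r s \<lhd> \<omega> (r * s) t"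
    and normal_idem:
      "e \<in> idempotents \<Longrightarrow> f \<in> idempotents \<Longrightarrow> \<omega> e f = multiplier_one (D (e * f))"
    and normal_right: "\<omega> r (r\<^sup>\<star> * r) = multiplier_one (D r)"
    and normal_left: "\<omega> (r * r\<^sup>\<star>) r = multiplier_one (D r)"
    and normal_mixed:
      "e \<in> idempotents \<Longrightarrow> x \<in> D (s\<^sup>\<star> * e * s) \<Longrightarrow>
       \<omega> (s\<^sup>\<star>) e \<rhd> \<omega> (s\<^sup>\<star> * e) s \<rhd> x = \<omega> (s\<^sup>\<star>) s \<rhd> x"


section \<open>Complex Banach spaces with explicit carrier\<close>

record 'a normed_structure =
  vcarrier :: "'a set"
  vzero :: 'a
  vadd :: "'a \<Rightarrow> 'a \<Rightarrow> 'a"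
  vscale :: "complex \<Rightarrow> 'a \<Rightarrow> 'a"
  vnorm :: "'a \<Rightarrow> real"

definition vdist :: "'a normed_structure \<Rightarrow> 'a \<Rightarrow> 'a \<Rightarrow> real" where
  "vdist V x y = vnorm V (vadd V x (vscale V (-1) y))"

locale complex_banach_space =
  fixes V :: "'a normed_structure"
  assumes zero_closed: "vzero V \<in> vcarrier V"
    and add_closed: "x \<in> vcarrier V \<Longrightarrow> y \<in> vcarrier V \<Longrightarrow> vadd V x y \<in> vcarrier V"
    and scale_closed: "x \<in> vcarrier V \<Longrightarrow> vscale V c x \<in> vcarrier V"
    and add_assoc: "x \<in> vcarrier V \<Longrightarrow> y \<in> vcarrier V \<Longrightarrow> z \<in> vcarrier V \<Longrightarrow>
      vadd V (vadd V x y) z = vadd V x (vadd V y z)"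
    and add_commute: "x \<in> vcarrier V \<Longrightarrow> y \<in> vcarrier V \<Longrightarrow> vadd V x y = vadd V y x"
    and add_zero: "x \<in> vcarrier V \<Longrightarrow> vadd V x (vzero V) = x"
    and add_neg: "x \<in> vcarrier V \<Longrightarrow> vadd V x (vscale V (-1) x) = vzero V"
    and scale_add_right: "x \<in> vcarrier V \<Longrightarrow> y \<in> vcarrier V \<Longrightarrow>
      vscale V c (vadd V x y) = vadd V (vscale V c x) (vscale V c y)"
    and scale_add_left: "x \<in> vcarrier V \<Longrightarrow>
      vscale V (c + d) x = vadd V (vscale V c x) (vscale V d x)"
    and scale_scale: "x \<in> vcarrier V \<Longrightarrow> vscale V c (vscale V d x) = vscale V (c * d) x"
    and scale_one: "x \<in> vcarrier V \<Longrightarrow> vscale V 1 x = x"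
    and norm_nonneg: "x \<in> vcarrier V \<Longrightarrow> 0 \<le> vnorm V x"
    and norm_eq_zero: "x \<in> vcarrier V \<Longrightarrow> vnorm V x = 0 \<longleftrightarrow> x = vzero V"
    and norm_triangle: "x \<in> vcarrier V \<Longrightarrow> y \<in> vcarrier V \<Longrightarrow>
      vnorm V (vadd V x y) \<le> vnorm V x + vnorm V y"
    and norm_scale: "x \<in> vcarrier V \<Longrightarrow> vnorm V (vscale V c x) = cmod c * vnorm V x"
    and complete:
      "(\<And>n. X n \<in> vcarrier V) \<Longrightarrow>
       (\<forall>\<epsilon>>0. \<exists>N. \<forall>m\<ge>N. \<forall>n\<ge>N. vdist V (X m) (X n) < \<epsilon>) \<Longrightarrow>
       \<exists>x\<in>vcarrier V. (\<lambda>n. vdist V (X n) x) \<longlonglongrightarrow> 0"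

definition vsubspace :: "'a normed_structure \<Rightarrow> 'a set \<Rightarrow> bool" where
  "vsubspace V W \<longleftrightarrow> W \<subseteq> vcarrier V \<and> vzero V \<in> W \<and>
     (\<forall>x\<in>W. \<forall>y\<in>W. vadd V x y \<in> W) \<and> (\<forall>c. \<forall>x\<in>W. vscale V c x \<in> W)"

definition vspan :: "'a normed_structure \<Rightarrow> 'a set \<Rightarrow> 'a set" where
  "vspan V X = vsubspace V hull X"

definition vdense :: "'a normed_structure \<Rightarrow> 'a set \<Rightarrow> bool" where
  "vdense V X \<longleftrightarrow> X \<subseteq> vcarrier V \<and> (\<forall>x\<in>vcarrier V. \<forall>\<epsilon>>0. \<exists>y\<in>X. vdist V x y < \<epsilon>)"

definition isometric_linear ::
  "'a normed_structure \<Rightarrow> 'c normed_structure \<Rightarrow> ('a \<Rightarrow> 'c) \<Rightarrow> bool" where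
  "isometric_linear V W f \<longleftrightarrow>
     (\<forall>x\<in>vcarrier V. f x \<in> vcarrier W \<and> vnorm W (f x) = vnorm V x) \<and>
     (\<forall>x\<in>vcarrier V. \<forall>y\<in>vcarrier V. f (vadd V x y) = vadd W (f x) (f y)) \<and>
     (\<forall>c. \<forall>x\<in>vcarrier V. f (vscale V c x) = vscale W c (f x))"


section \<open>Fell bundles over inverse semigroups\<close>

text \<open>The type \<open>'a\<close> contains the total space: the fibres are pairwise disjoint subsets of it,
  each with its own Banach space structure. An element of a C*-algebra is positive if it
  has the form \<open>c\<^sup>* c\<close> with \<open>c\<close> in that algebra.\<close>

locale fell_bundle =
  fixes A :: "'s::inverse_semigroup \<Rightarrow> 'a normed_structure"
    and mul :: "'a \<Rightarrow> 'a \<Rightarrow> 'a"  (infixl "\<odot>" 70)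
    and invol :: "'a \<Rightarrow> 'a"
    and j :: "'s \<Rightarrow> 's \<Rightarrow> 'a \<Rightarrow> 'a"
  assumes banach: "complex_banach_space (A s)"
    and disjoint: "s \<noteq> t \<Longrightarrow> vcarrier (A s) \<inter> vcarrier (A t) = {}"
    and incl: "s \<preceq> t \<Longrightarrow> isometric_linear (A s) (A t) (j t s)"
    and mul_closed: "a \<in> vcarrier (A s) \<Longrightarrow> b \<in> vcarrier (A t) \<Longrightarrow> a \<odot> b \<in> vcarrier (A (s * t))"
    and mul_add_left:
      "a \<in> vcarrier (A s) \<Longrightarrow> a' \<in> vcarrier (A s) \<Longrightarrow> b \<in> vcarrier (A t) \<Longrightarrow>
       vadd (A s) a a' \<odot> b = vadd (A (s * t)) (a \<odot> b) (a' \<odot> b)"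
    and mul_add_right:
      "a \<in> vcarrier (A s) \<Longrightarrow> b \<in> vcarrier (A t) \<Longrightarrow> b' \<in> vcarrier (A t) \<Longrightarrow>
       a \<odot> vadd (A t) b b' = vadd (A (s * t)) (a \<odot> b) (a \<odot> b')"
    and mul_scale_left:
      "a \<in> vcarrier (A s) \<Longrightarrow> b \<in> vcarrier (A t) \<Longrightarrow>
       vscale (A s) c a \<odot> b = vscale (A (s * t)) c (a \<odot> b)"
    and mul_scale_right:
      "a \<in> vcarrier (A s) \<Longrightarrow> b \<in> vcarrier (A t) \<Longrightarrow>
       a \<odot> vscale (A t) c b = vscale (A (s * t)) c (a \<odot> b)"
    and mul_assoc:
      "a \<in> vcarrier (A r) \<Longrightarrow> b \<in> vcarrier (A s) \<Longrightarrow> d \<in> vcarrier (A t) \<Longrightarrow>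
       (a \<odot> b) \<odot> d = a \<odot> (b \<odot> d)"
    and norm_mul:
      "a \<in> vcarrier (A s) \<Longrightarrow> b \<in> vcarrier (A t) \<Longrightarrow>
       vnorm (A (s * t)) (a \<odot> b) \<le> vnorm (A s) a * vnorm (A t) b"
    and inv_closed: "a \<in> vcarrier (A s) \<Longrightarrow> invol a \<in> vcarrier (A (s\<^sup>\<star>))"
    and inv_add:
      "a \<in> vcarrier (A s) \<Longrightarrow> b \<in> vcarrier (A s) \<Longrightarrow>
       invol (vadd (A s) a b) = vadd (A (s\<^sup>\<star>)) (invol a) (invol b)"
    and inv_scale:
      "a \<in> vcarrier (A s) \<Longrightarrow> invol (vscale (A s) c a) = vscale (A (s\<^sup>\<star>)) (cnj c) (invol a)"
    and inv_inv: "a \<in> vcarrier (A s) \<Longrightarrow> invol (invol a) = a"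
    and norm_inv: "a \<in> vcarrier (A s) \<Longrightarrow> vnorm (A (s\<^sup>\<star>)) (invol a) = vnorm (A s) a"
    and inv_mul:
      "a \<in> vcarrier (A s) \<Longrightarrow> b \<in> vcarrier (A t) \<Longrightarrow> invol (a \<odot> b) = invol b \<odot> invol a"
    and norm_inv_mul:
      "a \<in> vcarrier (A s) \<Longrightarrow> vnorm (A (s\<^sup>\<star> * s)) (invol a \<odot> a) = (vnorm (A s) a)\<^sup>2"
    and inv_mul_positive:
      "a \<in> vcarrier (A s) \<Longrightarrow> \<exists>c\<in>vcarrier (A (s\<^sup>\<star> * s)). invol a \<odot> a = invol c \<odot> c"
    and incl_comp:
      "r \<preceq> s \<Longrightarrow> s \<preceq> t \<Longrightarrow> a \<in> vcarrier (A r) \<Longrightarrow> j t r a = j t s (j s r a)"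
    and incl_mul:
      "s \<preceq> t \<Longrightarrow> u \<preceq> v \<Longrightarrow> a \<in> vcarrier (A s) \<Longrightarrow> b \<in> vcarrier (A u) \<Longrightarrow>
       j t s a \<odot> j v u b = j (t * v) (s * u) (a \<odot> b)"
    and incl_inv:
      "s \<preceq> t \<Longrightarrow> a \<in> vcarrier (A s) \<Longrightarrow> invol (j t s a) = j (t\<^sup>\<star>) (s\<^sup>\<star>) (invol a)"

locale saturated_fell_bundle = fell_bundle +
  assumes saturated:
    "vdense (A (s * t)) (vspan (A (s * t)) {a \<odot> b |a b. a \<in> vcarrier (A s) \<and> b \<in> vcarrier (A t)})"

text \<open>For sets \<open>E\<close>, \<open>F\<close> with algebra-valued inner products: \<open>u\<close> is an adjointable operator from \<open>E\<close>
  to \<open>F\<close> with adjoint \<open>v\<close>. In Hilbert modules such maps are automatically linear, bounded and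
  module maps, and \<open>v\<close> is determined by \<open>u\<close>.\<close>

definition adjointable_with ::
  "'a set \<Rightarrow> ('a \<Rightarrow> 'a \<Rightarrow> 'c) \<Rightarrow> 'a set \<Rightarrow> ('a \<Rightarrow> 'a \<Rightarrow> 'c) \<Rightarrow> ('a \<Rightarrow> 'a) \<Rightarrow> ('a \<Rightarrow> 'a) \<Rightarrow> bool" where
  "adjointable_with E ipE F ipF u v \<longleftrightarrow> u \<in> E \<rightarrow> F \<and> v \<in> F \<rightarrow> E \<and>
     (\<forall>x\<in>E. \<forall>y\<in>F. ipF (u x) y = ipE x (v y))"

locale regular_fell_bundle = saturated_fell_bundle +
  assumes regular:
    "\<exists>u v. adjointable_with (vcarrier (A (s\<^sup>\<star> * s))) (\<lambda>x y. invol x \<odot> y)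
                            (vcarrier (A s)) (\<lambda>x y. invol x \<odot> y) u v \<and>
           (\<forall>x\<in>vcarrier (A (s\<^sup>\<star> * s)). v (u x) = x) \<and> (\<forall>y\<in>vcarrier (A s). u (v y) = y)"


section \<open>The Fell bundle of a twisted action\<close>

text \<open>The element \<open>b \<delta>\<^sub>s\<close> is the pair \<open>(b, s)\<close>.\<close>

definition tw_fibre :: "('s \<Rightarrow> 'b::cstar_algebra set) \<Rightarrow> 's \<Rightarrow> ('b \<times> 's) normed_structure" where
  "tw_fibre D s =
     \<lparr> vcarrier = D s \<times> {s},
       vzero = (0, s),
       vadd = (\<lambda>x y. (fst x + fst y, s)),
       vscale = (\<lambda>c x. (c *\<^sub>C fst x, s)),
       vnorm = (\<lambda>x. norm (fst x)) \<rparr>"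

definition \<beta>_inv ::
  "('s::inverse_semigroup \<Rightarrow> 'b set) \<Rightarrow> ('s \<Rightarrow> 'b \<Rightarrow> 'b) \<Rightarrow> 's \<Rightarrow> 'b \<Rightarrow> 'b" where
  "\<beta>_inv D \<beta> s = inv_into (D (s\<^sup>\<star>)) (\<beta> s)"

fun tw_mult ::
  "('s::inverse_semigroup \<Rightarrow> 'b::cstar_algebra set) \<Rightarrow> ('s \<Rightarrow> 'b \<Rightarrow> 'b) \<Rightarrow> ('s \<Rightarrow> 's \<Rightarrow> 'b multiplier) \<Rightarrow>
   'b \<times> 's \<Rightarrow> 'b \<times> 's \<Rightarrow> 'b \<times> 's" where
  "tw_mult D \<beta> \<omega> (a, s) (b, t) = (\<beta> s (\<beta>_inv D \<beta> s a * b) \<lhd> \<omega> s t, s * t)"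

fun tw_star ::
  "('s::inverse_semigroup \<Rightarrow> 'b::cstar_algebra set) \<Rightarrow> ('s \<Rightarrow> 'b \<Rightarrow> 'b) \<Rightarrow> ('s \<Rightarrow> 's \<Rightarrow> 'b multiplier) \<Rightarrow>
   'b \<times> 's \<Rightarrow> 'b \<times> 's" where
  "tw_star D \<beta> \<omega> (a, s) =
     (\<beta>_inv D \<beta> s (a\<^sup>\<dagger>) \<lhd> multiplier_star (D (s\<^sup>\<star> * s)) (\<omega> (s\<^sup>\<star>) s), s\<^sup>\<star>)"

definition tw_incl ::
  "('s::inverse_semigroup \<Rightarrow> 'b::cstar_algebra set) \<Rightarrow> ('s \<Rightarrow> 's \<Rightarrow> 'b multiplier) \<Rightarrow>
   's \<Rightarrow> 's \<Rightarrow> 'b \<times> 's \<Rightarrow> 'b \<times> 's" where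
  "tw_incl D \<omega> t s x = (fst x \<lhd> multiplier_star (D (t * (s\<^sup>\<star> * s))) (\<omega> t (s\<^sup>\<star> * s)), t)"

end

theory Submission
  imports Defs
begin

text \<open>The element \<open>a \<delta>\<^sub>s\<close> should be read as \<open>a v\<^sub>s\<close>, where the \<open>v\<^sub>s\<close> are formal unitaries with
  \<open>v\<^sub>s x = \<beta>\<^sub>s(x) v\<^sub>s\<close> and \<open>v\<^sub>s v\<^sub>t = \<omega>(s,t) v\<^sub>s\<^sub>t\<close>. Product, involution and inclusions of the bundle are
  what this reading dictates, and the axioms of a twisted action make it consistent.

  The composition law determines the domains: comparing domains and ranges of
  \<open>\<beta>\<^sub>r \<circ> \<beta>\<^sub>s = Ad\<^bsub>\<omega>(r,s)\<^esub> \<circ> \<beta>\<^sub>r\<^sub>s\<close> gives \<open>D\<^sub>s = D\<^sub>s\<^sub>s\<^sub>*\<close>, \<open>\<beta>\<^sub>r(D\<^sub>r\<^sub>* \<inter> D\<^sub>s) = D\<^sub>r\<^sub>s\<close> and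
  \<open>D\<^sub>e\<^sub>t = D\<^sub>e \<inter> D\<^sub>t\<close> for idempotent \<open>e\<close> (\<open>D_range\<close>, \<open>beta_mem_mult_iff\<close>, \<open>D_idempotent_mult\<close>).

  After that the algebraic axioms of the bundle become identities between twists. Associativity is
  the cocycle identity together with \<open>beta_act_comp\<close>, which computes an iterated right action. In the
  inner product the twists cancel, \<open>(a \<delta>\<^sub>s)\<^sup>* (c \<delta>\<^sub>s) = \<beta>\<^sub>s\<^sup>-\<^sup>1(a\<^sup>* c) \<delta>\<^sub>s\<^sub>*\<^sub>s\<close> (\<open>star_prod\<close>); this yields the
  C*-identity, positivity, and regularity with the unitary \<open>\<beta>\<^sub>s\<close>. That the involution reverses
  products is \<open>twist_sinv_mult\<close>, a combination of two cocycle identities with the normalisation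
  \<open>\<omega>(t\<^sup>*,e) \<omega>(t\<^sup>* e,t) = \<omega>(t\<^sup>*,t)\<close>. The inclusions rest on \<open>\<omega>(t,e f) = \<omega>(t,e) \<omega>(t e,f)\<close>
  (\<open>omega_idempotent_mult\<close>) and \<open>\<omega>(e,s) = \<omega>(s,s\<^sup>* e s)\<close> (\<open>omega_idempotent_left\<close>) for idempotents
  \<open>e\<close> and \<open>f\<close>; they are compatible with products because they are so in each factor separately
  (\<open>incl_prod_left\<close>, \<open>incl_prod_right\<close>).

  Four facts about C*-algebras are needed: closed ideals are self-adjoint, an element \<open>x\<close> of a closed
  ideal is a limit of products \<open>u x\<close> with \<open>u\<close> in the ideal, multipliers of one ideal preserve the
  others, and *-isomorphisms are isometric. They are derived without spectral theory from one
  construction: a small self-adjoint \<open>h\<close> is the imaginary part of a unitary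
  \<open>U = \<surd>(1 - h\<^sup>2) + i h\<close>, whose real part is found by iterating a contraction (\<open>ex_cosine_part\<close>).
  A *-homomorphism maps \<open>U\<close> to a unitary; it is therefore bounded, and then contractive by the
  C*-identity. Moreover \<open>1 - 2 h\<^sup>2\<close>, the real part of \<open>U\<^sup>2\<close>, has norm at most one, and its Cesaro means
  provide approximate units.\<close>

section \<open>Norm estimates in C*-algebras\<close>

lemma star_zero [simp]: "(0::'b::cstar_algebra)\<^sup>\<dagger> = 0"
  using star_add[of "0::'b" 0] by simp

lemma star_minus: "(- x :: 'b::cstar_algebra)\<^sup>\<dagger> = - x\<^sup>\<dagger>"
  using star_add[of x "- x"] by (simp add: eq_neg_iff_add_eq_0 add.commute)

lemma star_diff: "(x - y :: 'b::cstar_algebra)\<^sup>\<dagger> = x\<^sup>\<dagger> - y\<^sup>\<dagger>"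
  using star_add[of x "- y"] by (simp add: star_minus)

lemma star_scaleR: "(r *\<^sub>R x :: 'b::cstar_algebra)\<^sup>\<dagger> = r *\<^sub>R x\<^sup>\<dagger>"
  by (simp add: scaleR_scaleC star_scaleC)

lemma norm_star: "norm (x\<^sup>\<dagger> :: 'b::cstar_algebra) = norm x"
proof -
  have le: "norm y \<le> norm (y\<^sup>\<dagger>)" for y :: 'b
  proof (cases "y = 0")
    case False
    have "norm y * norm y \<le> norm (y\<^sup>\<dagger>) * norm y"
      using norm_mult_ineq[of "y\<^sup>\<dagger>" y] by (simp add: cstar_identity power2_eq_square)
    then show ?thesis using False by simp
  qed simp
  show ?thesis using le[of x] le[of "x\<^sup>\<dagger>"] by (simp add: star_star)
qed

lemma cstar_identity': "norm (x * x\<^sup>\<dagger> :: 'b::cstar_algebra) = (norm x)\<^sup>2"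
  using cstar_identity[of "x\<^sup>\<dagger>"] by (simp add: norm_star star_star)

lemma scaleC_minus: "(- c) *\<^sub>C x = - (c *\<^sub>C x :: 'b::cstar_algebra)"
  by (rule complex_space.scale_minus_left)

lemma closed_idealD:
  assumes "closed_ideal I"
  shows closed_ideal_closed: "closed I"
    and closed_ideal_zero: "0 \<in> I"
    and closed_ideal_add: "x \<in> I \<Longrightarrow> y \<in> I \<Longrightarrow> x + y \<in> I"
    and closed_ideal_diff: "x \<in> I \<Longrightarrow> y \<in> I \<Longrightarrow> x - y \<in> I"
    and closed_ideal_scaleC: "x \<in> I \<Longrightarrow> c *\<^sub>C x \<in> I"
    and closed_ideal_scaleR: "x \<in> I \<Longrightarrow> r *\<^sub>R x \<in> I"
    and closed_ideal_left: "x \<in> I \<Longrightarrow> b * x \<in> I"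
    and closed_ideal_right: "x \<in> I \<Longrightarrow> x * b \<in> I"
  using assms
  by (auto simp: closed_ideal_def scaleR_scaleC complex_space.subspace_0
      complex_space.subspace_add complex_space.subspace_diff complex_space.subspace_scale)

text \<open>The element \<open>c = 1 - \<surd>(1 - h\<^sup>2)\<close>, which exists without a unit: it is the fixed point of
  \<open>c \<mapsto> (h\<^sup>2 + c\<^sup>2) / 2\<close>, a contraction of the ball of radius \<open>1/2\<close>. It turns a small self-adjoint
  \<open>h\<close> into the imaginary part of the unitary \<open>(1 - c) + i h\<close>.\<close>

lemma ex_cosine_part:
  fixes h :: "'b::cstar_algebra"
  assumes I: "closed_ideal I" and h: "h \<in> I" "h\<^sup>\<dagger> = h" "norm h \<le> 1/2"
  obtains c where "c \<in> I" "c\<^sup>\<dagger> = c" "c * h = h * c" "h * h + c * c = c + c"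
proof -
  note id = closed_idealD[OF I]
  define X where "X = {c \<in> I. c\<^sup>\<dagger> = c \<and> c * h = h * c \<and> norm c \<le> 1/2}"
  define f where "f c = (1/2) *\<^sub>R (h * h + c * c)" for c
  have star_cont: "continuous_on UNIV (star :: 'b \<Rightarrow> 'b)"
  proof -
    have "bounded_linear (star :: 'b \<Rightarrow> 'b)"
      by (rule bounded_linear_intro[where K=1]) (simp_all add: star_add star_scaleR norm_star)
    then show ?thesis by (rule linear_continuous_on)
  qed
  have "closed X"
  proof -
    have "X = I \<inter> {c. c\<^sup>\<dagger> = c} \<inter> {c. c * h = h * c} \<inter> {c. norm c \<le> 1/2}"
      by (auto simp: X_def)
    then show ?thesis
      using star_cont
      by (auto intro!: closed_Int id(1) closed_Collect_eq closed_Collect_le continuous_intros)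
  qed
  then have "complete X" by (simp add: complete_eq_closed)
  moreover have "X \<noteq> {}" using id(2) by (auto simp: X_def intro!: exI[of _ 0])
  moreover have "f ` X \<subseteq> X"
  proof (rule image_subsetI)
    fix c assume "c \<in> X"
    then have c: "c \<in> I" "c\<^sup>\<dagger> = c" "c * h = h * c" "norm c \<le> 1/2" by (auto simp: X_def)
    have "norm (h * h + c * c) \<le> norm h * norm h + norm c * norm c"
      by (rule order_trans[OF norm_triangle_ineq]) (intro add_mono norm_mult_ineq)
    also have "\<dots> \<le> 1/2 * (1/2) + 1/2 * (1/2)"
      using h c by (intro add_mono mult_mono) auto
    finally have "norm (f c) \<le> 1/2" by (simp add: f_def)
    moreover have "(c * c) * h = h * (c * c)"
      using c(3) by (metis mult.assoc)
    ultimately show "f c \<in> X"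
      using c h id by (simp add: X_def f_def star_scaleR star_add star_mult algebra_simps)
  qed
  moreover have "dist (f x) (f y) \<le> 1/2 * dist x y" if "x \<in> X" "y \<in> X" for x y
  proof -
    note xyX = that
    from xyX have xy: "norm x \<le> 1/2" "norm y \<le> 1/2" by (auto simp: X_def)
    have "f x - f y = (1/2) *\<^sub>R (x * (x - y) + (x - y) * y)"
      by (simp add: f_def algebra_simps)
    then have "norm (f x - f y) = 1/2 * norm (x * (x - y) + (x - y) * y)" by simp
    also have "\<dots> \<le> 1/2 * (norm x * norm (x - y) + norm (x - y) * norm y)"
      by (intro mult_left_mono order_trans[OF norm_triangle_ineq] add_mono norm_mult_ineq) simp
    also have "\<dots> \<le> 1/2 * (1/2 * norm (x - y) + norm (x - y) * (1/2))"
      using xy by (intro mult_left_mono add_mono mult_right_mono) auto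
    finally show "dist (f x) (f y) \<le> 1/2 * dist x y" by (simp add: dist_norm)
  qed
  ultimately obtain c where c: "c \<in> X" "f c = c"
    using Banach_fix[of X "1/2" f] by auto
  have "h * h + c * c = c + c"
    using c(2) unfolding f_def by (metis scaleR_2 scaleR_scaleR mult_numeral_1 nonzero_mult_div_cancel_left scaleR_one times_divide_eq_right zero_neq_numeral numeral_One)
  then show thesis using that c(1) by (auto simp: X_def)
qed

text \<open>\<open>U y = y - c y + i h y\<close> and its adjoint \<open>V\<close> preserve the norm because \<open>V U = U V = 1\<close>; hence their
  combinations \<open>2 i h = U - V\<close> and \<open>2 - 4 h\<^sup>2 = U\<^sup>2 + V\<^sup>2\<close> have norm at most \<open>2\<close>.\<close>

lemma
  fixes h :: "'b::cstar_algebra"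
  assumes c: "c\<^sup>\<dagger> = c" "c * h = h * c" "h * h + c * c = c + c" and h: "h\<^sup>\<dagger> = h"
  shows norm_le_one: "norm h \<le> 1" and norm_one_minus: "norm (y - 2 *\<^sub>R (h * h * y)) \<le> norm y"
proof -
  define U where "U y = y - c * y + \<i> *\<^sub>C (h * y)" for y
  define V where "V y = y - c * y - \<i> *\<^sub>C (h * y)" for y
  have i_i: "\<i> *\<^sub>C \<i> *\<^sub>C y = - y" for y :: 'b
    by (simp add: scaleC_scaleC scaleC_minus)
  note lin = scaleC_add_right complex_space.scale_right_diff_distrib mult_scaleC_left
    mult_scaleC_right i_i algebra_simps
  have chh: "c * (h * y) = h * (c * y)" for y using c(2) by (metis mult.assoc)
  have hh: "h * (h * y) = c * y + c * y - c * (c * y)" for y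
    using c(3) by (metis add_diff_cancel_right' distrib_right mult.assoc)
  have VU: "V (U y) = y" and UV: "U (V y) = y" for y
    by (simp_all add: U_def V_def lin chh hh)
  have adj: "(U y)\<^sup>\<dagger> * z = y\<^sup>\<dagger> * V z" "(V y)\<^sup>\<dagger> * z = y\<^sup>\<dagger> * U z" for y z
    by (simp_all add: U_def V_def star_add star_diff star_mult star_scaleC c h lin scaleC_minus)
  have nU: "norm (U y) = norm y" and nV: "norm (V y) = norm y" for y
    using cstar_identity[of "U y"] cstar_identity[of "V y"] cstar_identity[of y]
    by (simp_all add: adj VU UV power2_eq_iff_nonneg)
  have hy: "norm (h * y) \<le> norm y" for y
  proof -
    have "U y - V y = (2 * \<i>) *\<^sub>C (h * y)"
      using scaleC_add_left[of \<i> \<i> "h * y"] by (simp add: U_def V_def)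
    then have "2 * norm (h * y) = norm (U y - V y)" by (simp add: norm_scaleC norm_mult)
    also have "\<dots> \<le> 2 * norm y" using norm_triangle_ineq4[of "U y" "V y"] by (simp add: nU nV)
    finally show ?thesis by simp
  qed
  have "norm h * norm h \<le> norm h"
    using hy[of h] cstar_identity[of h] by (simp add: h power2_eq_square)
  then show "norm h \<le> 1" by (cases "h = 0") (auto simp: mult_le_cancel_right1)
  have "U (U y) + V (V y) = 2 *\<^sub>R (y - 2 *\<^sub>R (h * h * y))"
    by (simp add: U_def V_def lin chh hh scaleR_2)
  then have "2 * norm (y - 2 *\<^sub>R (h * h * y)) = norm (U (U y) + V (V y))" by simp
  also have "\<dots> \<le> 2 * norm y"
    using norm_triangle_ineq[of "U (U y)" "V (V y)"] by (simp add: nU nV)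
  finally show "norm (y - 2 *\<^sub>R (h * h * y)) \<le> norm y" by simp
qed


section \<open>Approximate units\<close>

lemma closed_ideal_Int: "closed_ideal I \<Longrightarrow> closed_ideal J \<Longrightarrow> closed_ideal (I \<inter> J)"
  by (simp add: closed_ideal_def closed_Int complex_space.subspace_inter)

text \<open>Put \<open>h = x x\<^sup>*\<close>. Since \<open>S = 1 - 2 h\<^sup>2\<close> has norm at most one, its Cesaro means
  \<open>M = (1 + S + \<dots> + S\<^sup>n\<^sup>-\<^sup>1) / n\<close> satisfy \<open>2 h\<^sup>2 M = (1 - S\<^sup>n) / n \<longrightarrow> 0\<close>; the C*-identity carries this over
  from \<open>h\<^sup>2 M\<close> to \<open>M h\<close> and then to \<open>M x\<close>. The element \<open>u = 1 - M\<close> is a real polynomial in \<open>h\<close> without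
  constant term, hence lies in every ideal that contains \<open>x\<close> and is self-adjoint.\<close>

lemma ex_approximate_left_unit_small:
  fixes x :: "'b::cstar_algebra"
  assumes J: "closed_ideal J" and x: "x \<in> J" "norm x \<le> 1/2" and e: "e > 0"
  obtains u where "u \<in> J" "u\<^sup>\<dagger> = u" "norm (x - u * x) < e"
proof -
  note id = closed_idealD[OF J]
  define h where "h = x * x\<^sup>\<dagger>"
  have hs: "h\<^sup>\<dagger> = h" by (simp add: h_def star_mult star_star)
  have hJ: "h \<in> J" by (simp add: h_def x id)
  have nh: "norm h \<le> 1/4"
    using power_mono[OF x(2), of 2] by (simp add: h_def cstar_identity' power2_eq_square)
  obtain c where c: "c\<^sup>\<dagger> = c" "c * h = h * c" "h * h + c * c = c + c"
    using ex_cosine_part[OF J hJ hs] nh by auto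
  note S = norm_one_minus[OF c hs]
  \<comment> \<open>\<open>v k\<close> is \<open>1 - S\<^sup>k\<close>, written without the unit.\<close>
  define v where "v k = ((\<lambda>v. v + 2 *\<^sub>R (h * h) - 2 *\<^sub>R (h * h * v)) ^^ k) 0" for k
  have v0: "v 0 = 0" and vS: "v (Suc k) = v k + 2 *\<^sub>R (h * h) - 2 *\<^sub>R (h * h * v k)" for k
    by (simp_all add: v_def)
  have v: "v k \<in> J \<and> v k * h = h * v k \<and> (v k)\<^sup>\<dagger> = v k" for k
  proof (induction k)
    case (Suc k)
    then have "v k * (h * h) = h * h * v k" by (metis mult.assoc)
    moreover have "h * h * v k * h = h * (h * h * v k)" using Suc by (metis mult.assoc)
    ultimately show ?case
      using Suc hJ id by (simp add: vS star_add star_diff star_scaleR star_mult hs algebra_simps)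
  qed (simp add: v0 id)
  have nv: "norm (y - v k * y) \<le> norm y" for y k
  proof (induction k)
    case (Suc k)
    have "y - v (Suc k) * y = (y - v k * y) - 2 *\<^sub>R (h * h * (y - v k * y))"
      by (simp add: vS algebra_simps)
    then have "norm (y - v (Suc k) * y) \<le> norm (y - v k * y)"
      using S[of "y - v k * y"] by (simp only:)
    then show ?case using Suc by (rule order_trans)
  qed (simp add: v0)
  \<comment> \<open>The final estimate is \<open>norm (M x) ^ 6 \<le> norm (M h) ^ 3 \<le> 1 / n\<close>.\<close>
  obtain n :: nat where n: "n > 0" "1 / real n < e ^ 6"
    using reals_Archimedean[of "e ^ 6"] e
    by (metis divide_inverse mult_1 zero_less_Suc zero_less_power)
  define u where "u = (1 / real n) *\<^sub>R (\<Sum>k<n. v k)"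
  define M where "M y = y - u * y" for y
  have uJ: "u \<in> J"
  proof -
    have "(\<Sum>k<m. v k) \<in> J" for m by (induction m) (auto simp: id v)
    then show ?thesis by (simp add: u_def id)
  qed
  have us: "u\<^sup>\<dagger> = u"
  proof -
    have "(\<Sum>k<m. v k)\<^sup>\<dagger> = (\<Sum>k<m. v k)" for m
      by (induction m) (auto simp: v star_add)
    then show ?thesis by (simp add: u_def star_scaleR)
  qed
  have uh: "u * h = h * u" using v by (simp add: u_def sum_distrib_left sum_distrib_right)
  have M_eq: "M y = (1 / real n) *\<^sub>R (\<Sum>k<n. y - v k * y)" for y
    using n(1)
    by (simp add: M_def u_def sum_subtractf sum_distrib_right scaleR_right_diff_distrib
        sum_constant_scaleR del: sum_constant)
  have M: "norm (M y) \<le> norm y" for y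
  proof -
    have "norm (\<Sum>k<n. y - v k * y) \<le> real n * norm y"
      using sum_norm_bound[of "{..<n}" "\<lambda>k. y - v k * y" "norm y"] nv by simp
    then show ?thesis using n(1) by (simp add: M_eq field_simps)
  qed
  have hhM: "norm (h * (h * M y)) \<le> norm y / real n" for y
  proof -
    have v_diff: "2 *\<^sub>R (h * (h * (y - v k * y))) = v (Suc k) * y - v k * y" for k
      by (simp add: vS algebra_simps)
    have "2 *\<^sub>R (h * (h * M y)) = (1 / real n) *\<^sub>R (\<Sum>k<n. 2 *\<^sub>R (h * (h * (y - v k * y))))"
      by (simp add: M_eq scaleR_sum_right sum_distrib_left)
    also have "\<dots> = (1 / real n) *\<^sub>R (\<Sum>k<n. v (Suc k) * y - v k * y)"
      by (simp only: v_diff)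
    also have "(\<Sum>k<n. v (Suc k) * y - v k * y) = v n * y"
      by (subst sum_lessThan_telescope) (simp add: v0)
    finally have "norm (2 *\<^sub>R (h * (h * M y))) = norm ((1 / real n) *\<^sub>R (v n * y))"
      by (simp only:)
    then have "2 * norm (h * (h * M y)) = norm (v n * y) / real n" by simp
    moreover have "norm (v n * y) \<le> 2 * norm y"
      using norm_triangle_ineq4[of y "y - v n * y"] nv[of y n] by simp
    ultimately show ?thesis using n(1) by (simp add: field_simps)
  qed
  \<comment> \<open>\<open>M h\<close> is self-adjoint, so its fourth power has norm \<open>norm g ^ 4\<close>, while its third power contains
    the small factor \<open>h\<^sup>2 M\<close>.\<close>
  define g where "g = M h"
  have hM: "h * M y = M (h * y)" for y
    by (simp add: M_def right_diff_distrib) (metis uh mult.assoc)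
  have gy: "g * y = M (h * y)" for y
    by (simp add: g_def M_def left_diff_distrib mult.assoc)
  have gs: "g\<^sup>\<dagger> = g" by (simp add: g_def M_def star_diff star_mult us hs uh)
  have "norm (g * (g * g)) \<le> norm (h * (h * g))"
    by (simp add: gy hM) (meson M order_trans)
  also have "\<dots> \<le> norm h / real n" unfolding g_def by (rule hhM)
  also have "\<dots> \<le> 1 / real n" using nh n(1) by (simp add: field_simps)
  finally have g3: "norm (g * (g * g)) \<le> 1 / real n" .
  have "norm g ^ 4 = norm ((g * g) * (g * g))"
    using cstar_identity[of g] cstar_identity[of "g * g"] by (simp add: gs star_mult)
  also have "\<dots> \<le> norm g * norm (g * (g * g))"
    using norm_mult_ineq[of g "g * (g * g)"] by (simp add: mult.assoc)
  also have "\<dots> \<le> norm g * (1 / real n)" by (intro mult_left_mono g3) simp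
  finally have "norm g * norm g ^ 3 \<le> norm g * (1 / real n)"
    by (simp add: power_numeral_reduce)
  then have g_small: "norm g ^ 3 \<le> 1 / real n"
    by (cases "g = 0") (simp, metis mult_le_cancel_left_pos zero_less_norm_iff)
  have "(norm (M x))\<^sup>2 = norm (M x * (M x)\<^sup>\<dagger>)" by (simp add: cstar_identity')
  also have "M x * (M x)\<^sup>\<dagger> = M (M h)"
    by (simp add: M_def star_diff star_mult us h_def algebra_simps)
      (metis h_def uh mult.assoc)
  also have "norm \<dots> \<le> norm g" unfolding g_def by (rule M)
  finally have "((norm (M x))\<^sup>2) ^ 3 \<le> norm g ^ 3" by (rule power_mono) simp
  with g_small n(2) have "norm (M x) ^ 6 < e ^ 6" by (simp flip: power_mult)
  then have "norm (M x) < e" using e by (simp add: power_less_imp_less_base)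
  with uJ us show thesis by (auto intro!: that simp: M_def)
qed

lemma ex_approximate_left_unit:
  fixes x :: "'b::cstar_algebra"
  assumes J: "closed_ideal J" and x: "x \<in> J" and e: "e > 0"
  obtains u where "u \<in> J" "u\<^sup>\<dagger> = u" "norm (x - u * x) < e"
proof (cases "x = 0")
  case True
  then show thesis using that[of 0] e closed_ideal_zero[OF J] by simp
next
  case False
  define r where "r = 1 / (2 * norm x)"
  have r: "r > 0" "norm (r *\<^sub>R x) \<le> 1/2" using False by (simp_all add: r_def)
  obtain u where u: "u \<in> J" "u\<^sup>\<dagger> = u" "norm (r *\<^sub>R x - u * r *\<^sub>R x) < r * e"
    using ex_approximate_left_unit_small[OF J _ r(2), of "r * e"] r(1) e x closed_ideal_scaleR[OF J]
    by auto
  have "r * norm (x - u * x) = norm (r *\<^sub>R x - u * r *\<^sub>R x)"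
    using r(1) by (simp flip: scaleR_right_diff_distrib)
  then have "r * norm (x - u * x) < r * e" using u(3) by (simp only:)
  with u r(1) show thesis by (intro that[of u]) simp_all
qed

text \<open>Since \<open>u\<close> is self-adjoint, \<open>x \<approx> u x\<close> gives \<open>x\<^sup>* \<approx> x\<^sup>* u\<close>, and the latter lies in the ideal.\<close>

lemma closed_ideal_star:
  fixes x :: "'b::cstar_algebra"
  assumes J: "closed_ideal J" and x: "x \<in> J"
  shows "x\<^sup>\<dagger> \<in> J"
proof -
  have "\<exists>y\<in>J. dist y (x\<^sup>\<dagger>) < e" if "e > 0" for e
  proof -
    obtain u where u: "u \<in> J" "u\<^sup>\<dagger> = u" "norm (x - u * x) < e"
      using ex_approximate_left_unit[OF J x \<open>e > 0\<close>] .
    have "dist (x\<^sup>\<dagger> * u) (x\<^sup>\<dagger>) = norm ((x - u * x)\<^sup>\<dagger>)"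
      by (simp add: dist_norm star_diff star_mult u norm_minus_commute)
    moreover have "x\<^sup>\<dagger> * u \<in> J" using closed_ideal_left[OF J u(1)] .
    ultimately show ?thesis using u(3) by (metis norm_star)
  qed
  then show ?thesis
    using closed_ideal_closed[OF J] by (metis closure_approachable closure_closed)
qed

text \<open>The next two lemmas replace limits along approximate units by exact computations: two elements of
  an ideal are equal once they agree after multiplication with the ideal, because their difference
  can be multiplied with its own adjoint.\<close>

lemma closed_ideal_eqI_mult_right:
  fixes x y :: "'b::cstar_algebra"
  assumes J: "closed_ideal J" and xy: "x \<in> J" "y \<in> J"
    and eq: "\<And>z. z \<in> J \<Longrightarrow> x * z = y * z"
  shows "x = y"
proof -
  have "(x - y) * (x - y)\<^sup>\<dagger> = 0"
    using eq[of "(x - y)\<^sup>\<dagger>"] closed_ideal_star[OF J] closed_ideal_diff[OF J] xy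
    by (simp add: left_diff_distrib)
  then show ?thesis using cstar_identity'[of "x - y"] by simp
qed

lemma closed_ideal_eqI_mult_left:
  fixes x y :: "'b::cstar_algebra"
  assumes J: "closed_ideal J" and xy: "x \<in> J" "y \<in> J"
    and eq: "\<And>z. z \<in> J \<Longrightarrow> z * x = z * y"
  shows "x = y"
proof -
  have "(x - y)\<^sup>\<dagger> * (x - y) = 0"
    using eq[of "(x - y)\<^sup>\<dagger>"] closed_ideal_star[OF J] closed_ideal_diff[OF J] xy
    by (simp add: right_diff_distrib)
  then show ?thesis using cstar_identity[of "x - y"] by simp
qed

section \<open>Star-isomorphisms are isometric\<close>

text \<open>A small self-adjoint \<open>h\<close> is the imaginary part of a unitary. That unitary is described by algebraic
  identities, which \<open>f\<close> preserves without being known to be continuous; so \<open>f h\<close> is again the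
  imaginary part of a unitary, and \<open>f\<close> is bounded. Applied to the powers \<open>h\<^sup>m\<close> with \<open>m = 2\<^sup>n\<close>, whose norms
  are \<open>norm h ^ m\<close>, a bound for \<open>f\<close> improves to the bound one.\<close>

lemma star_hom_contractive:
  fixes f :: "'b::cstar_algebra \<Rightarrow> 'b"
  assumes I: "closed_ideal I" and lin: "linear_on I f"
    and mult: "\<And>x y. x \<in> I \<Longrightarrow> y \<in> I \<Longrightarrow> f (x * y) = f x * f y"
    and star: "\<And>x. x \<in> I \<Longrightarrow> f (x\<^sup>\<dagger>) = (f x)\<^sup>\<dagger>"
    and x: "x \<in> I"
  shows "norm (f x) \<le> norm x"
proof -
  note id = closed_idealD[OF I]
  have add: "f (x + y) = f x + f y" if "x \<in> I" "y \<in> I" for x y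
    using lin that by (simp add: linear_on_def)
  have scale: "f (r *\<^sub>R x) = r *\<^sub>R f x" if "x \<in> I" for r x
    using lin that by (simp add: linear_on_def scaleR_scaleC)
  have zero: "f 0 = 0" using scale[of 0 0] id by simp
  have small: "norm (f h) \<le> 1" if h: "h \<in> I" "h\<^sup>\<dagger> = h" "norm h \<le> 1/2" for h
  proof -
    obtain c where c: "c \<in> I" "c\<^sup>\<dagger> = c" "c * h = h * c" "h * h + c * c = c + c"
      using ex_cosine_part[OF I h] .
    have "f h * f h + f c * f c = f c + f c"
      using arg_cong[OF c(4), of f] c(1) h(1) id by (simp only: add mult)
    moreover have "f c * f h = f h * f c" using arg_cong[OF c(3), of f] c(1) h(1) by (simp only: mult)
    moreover have "(f c)\<^sup>\<dagger> = f c" "(f h)\<^sup>\<dagger> = f h" using c h star by (metis, metis)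
    ultimately show ?thesis by (intro norm_le_one[of "f c"])
  qed
  have bound2: "norm (f h) \<le> 2 * norm h" if h: "h \<in> I" "h\<^sup>\<dagger> = h" for h
  proof (cases "h = 0")
    case False
    have "norm (f ((1 / (2 * norm h)) *\<^sub>R h)) \<le> 1"
      using False h id by (intro small) (auto simp: star_scaleR)
    then show ?thesis using False h by (simp add: scale field_simps)
  qed (simp add: zero)
  have pow: "norm (f h) ^ (2 ^ n) \<le> 2 * norm h ^ (2 ^ n)" if "h \<in> I" "h\<^sup>\<dagger> = h" for h n
    using that
  proof (induction n arbitrary: h)
    case 0
    then show ?case using bound2 by simp
  next
    case (Suc n)
    have "norm (f (h * h)) = (norm (f h))\<^sup>2"
      using Suc.prems cstar_identity[of "f h"] by (simp add: mult flip: star)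
    moreover have "norm (h * h) = (norm h)\<^sup>2"
      using Suc.prems cstar_identity[of h] by simp
    ultimately show ?case
      using Suc.IH[of "h * h"] Suc.prems id by (simp add: star_mult flip: power_mult)
  qed
  have sa: "norm (f h) \<le> norm h" if h: "h \<in> I" "h\<^sup>\<dagger> = h" for h
  proof (rule ccontr)
    assume less: "\<not> norm (f h) \<le> norm h"
    then have "h \<noteq> 0" using zero by auto
    define q where "q = norm (f h) / norm h"
    have q: "q > 1" using less \<open>h \<noteq> 0\<close> by (simp add: q_def)
    obtain n where n: "q ^ n > 2" using real_arch_pow[OF q] by blast
    also have "q ^ n \<le> q ^ (2 ^ n)" using q by (intro power_increasing) auto
    also have "\<dots> \<le> 2" using pow[OF h, of n] \<open>h \<noteq> 0\<close> by (simp add: q_def power_divide field_simps)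
    finally show False by simp
  qed
  have "(norm (f x))\<^sup>2 = norm (f (x\<^sup>\<dagger> * x))"
    using x closed_ideal_star[OF I] by (simp add: mult star cstar_identity)
  also have "\<dots> \<le> norm (x\<^sup>\<dagger> * x)" using x id by (intro sa) (auto simp: star_mult star_star)
  also have "\<dots> = (norm x)\<^sup>2" by (rule cstar_identity)
  finally show ?thesis by (rule power2_le_imp_le) simp
qed

lemma star_isomorphism_inv:
  fixes f :: "'b::cstar_algebra \<Rightarrow> 'b"
  assumes I: "closed_ideal I" and f: "star_isomorphism I J f"
  shows "star_isomorphism J I (inv_into I f)"
proof -
  note id = closed_idealD[OF I] closed_ideal_star[OF I]
  have bij: "bij_betw f I J" using f by (simp add: star_isomorphism_def)
  then have J: "J = f ` I" and inv: "\<And>x. x \<in> I \<Longrightarrow> inv_into I f (f x) = x"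
    by (auto simp: bij_betw_def)
  show ?thesis
    unfolding star_isomorphism_def linear_on_def
  proof (intro conjI ballI allI)
    show "bij_betw (inv_into I f) J I" using bij by (rule bij_betw_inv_into)
  next
    fix x y assume "x \<in> J" "y \<in> J"
    then obtain a b where ab: "a \<in> I" "b \<in> I" "x = f a" "y = f b" by (auto simp: J)
    have "f (a + b) = x + y" "f (a * b) = x * y"
      using f ab by (auto simp: star_isomorphism_def linear_on_def)
    then show "inv_into I f (x + y) = inv_into I f x + inv_into I f y"
      "inv_into I f (x * y) = inv_into I f x * inv_into I f y"
      using inv[of "a + b"] inv[of "a * b"] ab id by (simp_all add: inv)
  next
    fix x c assume "x \<in> J"
    then obtain a where a: "a \<in> I" "x = f a" by (auto simp: J)
    have "f (c *\<^sub>C a) = c *\<^sub>C x" using f a by (auto simp: star_isomorphism_def linear_on_def)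
    then show "inv_into I f (c *\<^sub>C x) = c *\<^sub>C inv_into I f x"
      using inv[of "c *\<^sub>C a"] a id by (simp add: inv)
  next
    fix x assume "x \<in> J"
    then obtain a where a: "a \<in> I" "x = f a" by (auto simp: J)
    have "f (a\<^sup>\<dagger>) = x\<^sup>\<dagger>" using f a by (auto simp: star_isomorphism_def)
    then show "inv_into I f (x\<^sup>\<dagger>) = (inv_into I f x)\<^sup>\<dagger>"
      using inv[of "a\<^sup>\<dagger>"] a id by (simp add: inv)
  qed
qed

lemma star_isomorphism_norm:
  fixes f :: "'b::cstar_algebra \<Rightarrow> 'b"
  assumes I: "closed_ideal I" and J: "closed_ideal J" and f: "star_isomorphism I J f"
    and x: "x \<in> I"
  shows "norm (f x) = norm x"
proof (rule antisym)
  show "norm (f x) \<le> norm x"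
    using f by (intro star_hom_contractive[OF I _ _ _ x]) (auto simp: star_isomorphism_def)
  have "f x \<in> J" and "inv_into I f (f x) = x"
    using f x by (auto simp: star_isomorphism_def bij_betw_def)
  moreover have "norm (inv_into I f (f x)) \<le> norm (f x)"
    using star_isomorphism_inv[OF I f] \<open>f x \<in> J\<close>
    by (intro star_hom_contractive[OF J]) (auto simp: star_isomorphism_def)
  ultimately show "norm x \<le> norm (f x)" by simp
qed


section \<open>Multipliers of ideals\<close>

lemma multiplierD:
  assumes "w \<in> multipliers I"
  shows multiplier_left_mem: "x \<in> I \<Longrightarrow> w \<rhd> x \<in> I"
    and multiplier_right_mem: "x \<in> I \<Longrightarrow> x \<lhd> w \<in> I"
    and multiplier_left_assoc: "x \<in> I \<Longrightarrow> y \<in> I \<Longrightarrow> w \<rhd> (x * y) = (w \<rhd> x) * y"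
    and multiplier_right_assoc: "x \<in> I \<Longrightarrow> y \<in> I \<Longrightarrow> (x * y) \<lhd> w = x * (y \<lhd> w)"
    and multiplier_middle_assoc: "x \<in> I \<Longrightarrow> y \<in> I \<Longrightarrow> (x \<lhd> w) * y = x * (w \<rhd> y)"
    and multiplier_left_linear: "linear_on I (fst w)"
    and multiplier_right_linear: "linear_on I (snd w)"
    and multiplier_left_bounded: "\<exists>K. \<forall>x\<in>I. norm (w \<rhd> x) \<le> K * norm x"
    and multiplier_right_bounded: "\<exists>K. \<forall>x\<in>I. norm (x \<lhd> w) \<le> K * norm x"
  using assms by (simp_all add: multipliers_def case_prod_beta PiE_iff)

lemma linear_on_diff:
  assumes "linear_on I f" "closed_ideal I" "x \<in> I" "y \<in> I"
  shows "f (x - y) = f x - f y"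
proof -
  have "f (x + (-1) *\<^sub>C y) = f x + (-1) *\<^sub>C f y"
    using assms(1,3,4) closed_ideal_scaleC[OF assms(2)] unfolding linear_on_def by metis
  then show ?thesis by (simp add: scaleC_minus)
qed

text \<open>An element \<open>x \<in> I \<inter> J\<close> is a limit of elements \<open>u x\<close> with \<open>u \<in> I \<inter> J\<close>; hence \<open>x w = lim u (x w)\<close> lies
  in \<open>J\<close>.\<close>

lemma multiplier_right_mem_ideal:
  fixes x :: "'b::cstar_algebra"
  assumes w: "w \<in> multipliers I" and I: "closed_ideal I" and J: "closed_ideal J"
    and x: "x \<in> I" "x \<in> J"
  shows "x \<lhd> w \<in> J"
proof -
  obtain K where K: "\<And>x. x \<in> I \<Longrightarrow> norm (x \<lhd> w) \<le> K * norm x"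
    using multiplier_right_bounded[OF w] by auto
  have IJ: "closed_ideal (I \<inter> J)" using I J by (rule closed_ideal_Int)
  have "\<exists>y\<in>J. dist y (x \<lhd> w) < e" if "e > 0" for e
  proof -
    obtain u where u: "u \<in> I" "u \<in> J" "norm (x - u * x) < e / (\<bar>K\<bar> + 1)"
      using ex_approximate_left_unit[OF IJ, of x "e / (\<bar>K\<bar> + 1)"] x \<open>e > 0\<close>
      by (auto simp: add_nonneg_pos)
    have mem: "u * x \<in> I" "x - u * x \<in> I"
      using u x closed_ideal_left[OF I] closed_ideal_diff[OF I] by auto
    have "dist (u * (x \<lhd> w)) (x \<lhd> w) = norm ((x - u * x) \<lhd> w)"
      using u x mem
      by (simp add: dist_norm linear_on_diff[OF multiplier_right_linear[OF w] I]
          multiplier_right_assoc[OF w] norm_minus_commute)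
    also have "\<dots> \<le> (\<bar>K\<bar> + 1) * norm (x - u * x)"
      by (rule order_trans[OF K[OF mem(2)]]) (auto intro!: mult_right_mono)
    also have "\<dots> < e" using u(3) by (simp add: field_simps)
    finally show ?thesis using closed_ideal_right[OF J u(2)] by blast
  qed
  then show ?thesis
    using closed_ideal_closed[OF J] by (metis closure_approachable closure_closed)
qed

lemma multiplier_star_left: "x \<in> I \<Longrightarrow> multiplier_star I w \<rhd> x = (x\<^sup>\<dagger> \<lhd> w)\<^sup>\<dagger>"
  and multiplier_star_right: "x \<in> I \<Longrightarrow> x \<lhd> multiplier_star I w = (w \<rhd> x\<^sup>\<dagger>)\<^sup>\<dagger>"
  by (simp_all add: multiplier_star_def)

lemma multiplier_star_mem:
  fixes I :: "'b::cstar_algebra set"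
  assumes I: "closed_ideal I" and w: "w \<in> multipliers I"
  shows "multiplier_star I w \<in> multipliers I"
proof -
  note id = closed_idealD[OF I] closed_ideal_star[OF I]
  note m = multiplierD[OF w]
  obtain K K' where K: "\<And>x. x \<in> I \<Longrightarrow> norm (w \<rhd> x) \<le> K * norm x"
    "\<And>x. x \<in> I \<Longrightarrow> norm (x \<lhd> w) \<le> K' * norm x"
    using m(8,9) by blast
  have "linear_on I (fst (multiplier_star I w))" "linear_on I (snd (multiplier_star I w))"
    using m(6,7) by (simp_all add: linear_on_def multiplier_star_def id star_add star_scaleC)
  moreover have "\<exists>K. \<forall>x\<in>I. norm (multiplier_star I w \<rhd> x) \<le> K * norm x"
    "\<exists>K. \<forall>x\<in>I. norm (x \<lhd> multiplier_star I w) \<le> K * norm x"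
    using K[OF id(9)] by (auto simp: multiplier_star_def norm_star)
  moreover have "fst (multiplier_star I w) \<in> I \<rightarrow>\<^sub>E I" "snd (multiplier_star I w) \<in> I \<rightarrow>\<^sub>E I"
    using m id by (auto simp: multiplier_star_def)
  moreover have "multiplier_star I w \<rhd> (x * y) = (multiplier_star I w \<rhd> x) * y"
    "(x * y) \<lhd> multiplier_star I w = x * (y \<lhd> multiplier_star I w)"
    "(x \<lhd> multiplier_star I w) * y = x * (multiplier_star I w \<rhd> y)" if "x \<in> I" "y \<in> I" for x y
  proof -
    show "multiplier_star I w \<rhd> (x * y) = (multiplier_star I w \<rhd> x) * y"
      "(x * y) \<lhd> multiplier_star I w = x * (y \<lhd> multiplier_star I w)"
      using that m(3,4) id by (simp_all add: multiplier_star_def star_mult star_star)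
    have "(x \<lhd> multiplier_star I w) * y = (y\<^sup>\<dagger> * (w \<rhd> x\<^sup>\<dagger>))\<^sup>\<dagger>"
      using that by (simp add: multiplier_star_def star_mult star_star)
    also have "\<dots> = x * (multiplier_star I w \<rhd> y)"
      using that id by (simp add: multiplier_star_def star_mult star_star flip: m(5))
    finally show "(x \<lhd> multiplier_star I w) * y = x * (multiplier_star I w \<rhd> y)" .
  qed
  ultimately show ?thesis
    by (auto simp: multipliers_def case_prod_beta)
qed

lemma multiplier_left_mem_ideal:
  fixes x :: "'b::cstar_algebra"
  assumes w: "w \<in> multipliers I" and I: "closed_ideal I" and J: "closed_ideal J"
    and x: "x \<in> I" "x \<in> J"
  shows "w \<rhd> x \<in> J"
proof -
  have "x\<^sup>\<dagger> \<lhd> multiplier_star I w \<in> J"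
    using multiplier_star_mem[OF I w] I J x
    by (intro multiplier_right_mem_ideal[where I=I]) (auto intro: closed_ideal_star)
  then have "(w \<rhd> x)\<^sup>\<dagger> \<in> J"
    using closed_ideal_star[OF I x(1)] by (simp add: multiplier_star_right star_star)
  then show ?thesis using closed_ideal_star[OF J, of "(w \<rhd> x)\<^sup>\<dagger>"] by (simp add: star_star)
qed

text \<open>Only the factor next to a multiplier of \<open>I\<close> has to lie in \<open>I\<close>: multiplication with a test element
  \<open>z \<in> I\<close> absorbs the other factor into \<open>z b \<in> I\<close>.\<close>

lemma multiplier_right_assoc_any:
  fixes x :: "'b::cstar_algebra"
  assumes I: "closed_ideal I" and w: "w \<in> multipliers I" and x: "x \<in> I"
  shows "(b * x) \<lhd> w = b * (x \<lhd> w)"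
proof (rule closed_ideal_eqI_mult_left[OF I])
  note id = closed_idealD[OF I] and m = multiplierD[OF w]
  show "(b * x) \<lhd> w \<in> I" "b * (x \<lhd> w) \<in> I" using x m(2) id by auto
  fix z assume z: "z \<in> I"
  have "z * ((b * x) \<lhd> w) = ((z * b) * x) \<lhd> w"
    using m(4)[of z "b * x"] z x id by (simp add: mult.assoc)
  also have "\<dots> = (z * b) * (x \<lhd> w)" using m(4) z x id by simp
  finally show "z * ((b * x) \<lhd> w) = z * (b * (x \<lhd> w))" by (simp add: mult.assoc)
qed

lemma multiplier_left_assoc_any:
  fixes x :: "'b::cstar_algebra"
  assumes I: "closed_ideal I" and w: "w \<in> multipliers I" and x: "x \<in> I"
  shows "w \<rhd> (x * b) = (w \<rhd> x) * b"
proof (rule closed_ideal_eqI_mult_right[OF I])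
  note id = closed_idealD[OF I] and m = multiplierD[OF w]
  show "w \<rhd> (x * b) \<in> I" "(w \<rhd> x) * b \<in> I" using x m(1) id by auto
  fix z assume z: "z \<in> I"
  have "(w \<rhd> (x * b)) * z = w \<rhd> (x * (b * z))"
    using m(3)[of "x * b" z] z x id by (simp add: mult.assoc)
  also have "\<dots> = (w \<rhd> x) * (b * z)" using m(3) z x id by simp
  finally show "(w \<rhd> (x * b)) * z = (w \<rhd> x) * b * z" by (simp add: mult.assoc)
qed

text \<open>Associativity \<open>(v x) w = v (x w)\<close> for multipliers of two different ideals. A test element
  \<open>z \<in> I \<inter> J\<close> turns \<open>v\<close> into the element \<open>z v\<close>, over which \<open>w\<close> passes.\<close>

lemma multiplier_left_right_commute:
  fixes x :: "'b::cstar_algebra"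
  assumes I: "closed_ideal I" and v: "v \<in> multipliers I"
    and J: "closed_ideal J" and w: "w \<in> multipliers J"
    and x: "x \<in> I" "x \<in> J"
  shows "(v \<rhd> x) \<lhd> w = v \<rhd> (x \<lhd> w)"
proof (rule closed_ideal_eqI_mult_left[OF closed_ideal_Int[OF I J]])
  have mem: "v \<rhd> x \<in> I" "v \<rhd> x \<in> J" "x \<lhd> w \<in> I" "x \<lhd> w \<in> J"
    using x multiplierD(1)[OF v] multiplierD(2)[OF w] multiplier_left_mem_ideal[OF v I J]
      multiplier_right_mem_ideal[OF w J I] by auto
  then show "(v \<rhd> x) \<lhd> w \<in> I \<inter> J" "v \<rhd> (x \<lhd> w) \<in> I \<inter> J"
    using multiplierD(1)[OF v] multiplierD(2)[OF w] multiplier_left_mem_ideal[OF v I J]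
      multiplier_right_mem_ideal[OF w J I] by auto
  fix z assume z: "z \<in> I \<inter> J"
  have "z * ((v \<rhd> x) \<lhd> w) = (z * (v \<rhd> x)) \<lhd> w"
    using mem by (simp add: multiplier_right_assoc_any[OF J w])
  also have "\<dots> = ((z \<lhd> v) * x) \<lhd> w"
    using z x by (simp add: multiplier_middle_assoc[OF v])
  also have "\<dots> = (z \<lhd> v) * (x \<lhd> w)" using x by (simp add: multiplier_right_assoc_any[OF J w])
  also have "\<dots> = z * (v \<rhd> (x \<lhd> w))" using z mem by (simp add: multiplier_middle_assoc[OF v])
  finally show "z * ((v \<rhd> x) \<lhd> w) = z * (v \<rhd> (x \<lhd> w))" .
qed

lemma multiplier_one_right: "x \<in> I \<Longrightarrow> x \<lhd> multiplier_one I = x"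
  and multiplier_one_left: "x \<in> I \<Longrightarrow> multiplier_one I \<rhd> x = x"
  by (simp_all add: multiplier_one_def)

lemma unitary_multiplier_is_multiplier: "w \<in> unitary_multipliers I \<Longrightarrow> w \<in> multipliers I"
  by (simp add: unitary_multipliers_def)

lemma multiplier_eqI:
  assumes "v \<in> multipliers I" "w \<in> multipliers I"
    and "\<And>x. x \<in> I \<Longrightarrow> v \<rhd> x = w \<rhd> x" "\<And>x. x \<in> I \<Longrightarrow> x \<lhd> v = x \<lhd> w"
  shows "v = w"
proof (rule prod_eqI)
  have mem: "fst v \<in> I \<rightarrow>\<^sub>E I" "fst w \<in> I \<rightarrow>\<^sub>E I" "snd v \<in> I \<rightarrow>\<^sub>E I" "snd w \<in> I \<rightarrow>\<^sub>E I"
    using assms(1,2) by (simp_all add: multipliers_def case_prod_beta)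
  show "fst v = fst w" by (rule PiE_ext[OF mem(1,2)]) (rule assms(3))
  show "snd v = snd w" by (rule PiE_ext[OF mem(3,4)]) (rule assms(4))
qed

context
  fixes I :: "'b::cstar_algebra set" and w
  assumes I: "closed_ideal I" and w: "w \<in> unitary_multipliers I"
begin

private lemma wm: "w \<in> multipliers I" "multiplier_star I w \<in> multipliers I"
  using w multiplier_star_mem[OF I] by (auto simp: unitary_multipliers_def)

lemma unitary_cancel:
  assumes "x \<in> I"
  shows "multiplier_star I w \<rhd> w \<rhd> x = x" "w \<rhd> multiplier_star I w \<rhd> x = x"
    "x \<lhd> multiplier_star I w \<lhd> w = x" "x \<lhd> w \<lhd> multiplier_star I w = x"
proof -
  let ?v = "multiplier_star I w"
  have vw: "multiplier_mult I ?v w = multiplier_one I"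
    and wv: "multiplier_mult I w ?v = multiplier_one I"
    using w by (auto simp: unitary_multipliers_def)
  show "?v \<rhd> w \<rhd> x = x" "w \<rhd> ?v \<rhd> x = x" "x \<lhd> ?v \<lhd> w = x" "x \<lhd> w \<lhd> ?v = x"
    using arg_cong[OF vw, of "\<lambda>v. v \<rhd> x"] arg_cong[OF wv, of "\<lambda>v. v \<rhd> x"]
      arg_cong[OF vw, of "\<lambda>v. x \<lhd> v"] arg_cong[OF wv, of "\<lambda>v. x \<lhd> v"] assms
    by (simp_all add: multiplier_mult_def multiplier_one_def)
qed

lemma star_unitary_right: "x \<in> I \<Longrightarrow> (x \<lhd> w)\<^sup>\<dagger> = multiplier_star I w \<rhd> x\<^sup>\<dagger>"
  and star_unitary_left: "x \<in> I \<Longrightarrow> (w \<rhd> x)\<^sup>\<dagger> = x\<^sup>\<dagger> \<lhd> multiplier_star I w"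
  using closed_ideal_star[OF I] by (simp_all add: multiplier_star_def star_star)

lemma multiplier_star_star: "multiplier_star I (multiplier_star I w) = w"
  by (rule multiplier_eqI[OF multiplier_star_mem[OF I wm(2)] wm(1)])
    (simp_all add: closed_ideal_star[OF I] multiplier_star_left multiplier_star_right star_star)

lemma multiplier_star_unitary: "multiplier_star I w \<in> unitary_multipliers I"
  using w multiplier_star_mem[OF I] by (simp add: unitary_multipliers_def multiplier_star_star)

text \<open>\<open>(x w) (x w)\<^sup>* = x w w\<^sup>* x\<^sup>* = x x\<^sup>*\<close>.\<close>

lemma norm_unitary_right:
  assumes x: "x \<in> I"
  shows "norm (x \<lhd> w) = norm x"
proof -
  have "(x \<lhd> w) * (x \<lhd> w)\<^sup>\<dagger> = x * x\<^sup>\<dagger>"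
    using x closed_ideal_star[OF I x] multiplier_left_mem[OF wm(2)]
    by (simp add: star_unitary_right multiplier_middle_assoc[OF wm(1)] unitary_cancel)
  then show ?thesis
    using cstar_identity'[of x] cstar_identity'[of "x \<lhd> w"] by (simp add: power2_eq_iff_nonneg)
qed

end

section \<open>Inverse semigroups\<close>


lemma sinv_sinv [simp]: "(s\<^sup>\<star>)\<^sup>\<star> = (s::'s::inverse_semigroup)"
  by (rule sinv_unique[OF sinv_mult_sinv mult_sinv_mult, symmetric])

lemma mult_sinv_mult': "s * (s\<^sup>\<star> * s) = (s::'s::inverse_semigroup)"
  using mult_sinv_mult by (simp add: mult.assoc)

lemma idempotents_iff: "e \<in> idempotents \<longleftrightarrow> e * e = e"
  by (simp add: idempotents_def)

lemma idempotent_sinv: "e \<in> idempotents \<Longrightarrow> e\<^sup>\<star> = (e::'s::inverse_semigroup)"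
  using sinv_unique[of e e] by (simp add: idempotents_iff)

lemma idempotent_source: "s\<^sup>\<star> * s \<in> idempotents"
  and idempotent_range: "s * s\<^sup>\<star> \<in> (idempotents :: 's::inverse_semigroup set)"
  by (simp_all add: idempotents_iff mult.assoc[symmetric] mult_sinv_mult sinv_mult_sinv)

text \<open>With \<open>x = (e f)\<^sup>*\<close>, also \<open>f x e\<close> is an inverse of \<open>e f\<close>, so \<open>x = f x e\<close>, which is
  idempotent; hence so is \<open>e f = x\<^sup>* = x\<close>.\<close>

lemma idempotent_mult:
  fixes e f :: "'s::inverse_semigroup"
  assumes e: "e \<in> idempotents" and f: "f \<in> idempotents"
  shows "e * f \<in> idempotents"
proof -
  define x where "x = (e * f)\<^sup>\<star>"
  have ee: "e * e = e" "e * (e * z) = e * z" and ff: "f * f = f" "f * (f * z) = f * z" for z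
    using e f by (simp_all add: idempotents_iff flip: mult.assoc)
  have 1: "e * (f * (x * (e * f))) = e * f" and 2: "x * (e * (f * x)) = x"
    using mult_sinv_mult[of "e * f"] sinv_mult_sinv[of "e * f"] by (simp_all add: x_def mult.assoc)
  have two: "x * (e * (f * (x * z))) = x * z" for z
    using 2 by (metis mult.assoc)
  have fxe: "f * (x * e) = x"
    unfolding x_def
    by (rule sinv_unique; fold x_def) (simp_all add: mult.assoc ee ff 1 two)
  have "(f * (x * e)) * (f * (x * e)) = f * (x * e)"
    by (simp add: mult.assoc two)
  then have "x * x = x" by (simp only: fxe)
  then have "x \<in> idempotents" by (simp add: idempotents_iff)
  moreover from idempotent_sinv[OF this] have "x = e * f" by (simp add: x_def)
  ultimately show ?thesis by simp
qed

lemma idempotent_commute: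
  fixes e f :: "'s::inverse_semigroup"
  assumes e: "e \<in> idempotents" and f: "f \<in> idempotents"
  shows "e * f = f * e"
proof -
  have ee: "e * e = e" "e * (e * z) = e * z" and ff: "f * f = f" "f * (f * z) = f * z" for z
    using e f by (simp_all add: idempotents_iff flip: mult.assoc)
  have "e * (f * (e * f)) = e * f" "f * (e * (f * e)) = f * e"
    using idempotent_mult[OF e f] idempotent_mult[OF f e] by (simp_all add: idempotents_iff mult.assoc)
  then have "f * e = (e * f)\<^sup>\<star>"
    by (intro sinv_unique) (simp_all add: mult.assoc ee ff)
  then show ?thesis using idempotent_sinv[OF idempotent_mult[OF e f]] by simp
qed

lemma sinv_mult: "(s * t)\<^sup>\<star> = t\<^sup>\<star> * (s\<^sup>\<star> :: 's::inverse_semigroup)"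
proof (rule sinv_unique[symmetric])
  have c: "t * t\<^sup>\<star> * (s\<^sup>\<star> * s) = s\<^sup>\<star> * s * (t * t\<^sup>\<star>)"
    by (intro idempotent_commute idempotent_source idempotent_range)
  have "s * t * (t\<^sup>\<star> * s\<^sup>\<star>) * (s * t) = s * (t * t\<^sup>\<star> * (s\<^sup>\<star> * s)) * t" by (simp add: mult.assoc)
  also have "\<dots> = (s * s\<^sup>\<star> * s) * (t * t\<^sup>\<star> * t)" by (simp only: c) (simp add: mult.assoc)
  finally show "s * t * (t\<^sup>\<star> * s\<^sup>\<star>) * (s * t) = s * t" by (simp add: mult_sinv_mult)
  have "t\<^sup>\<star> * s\<^sup>\<star> * (s * t) * (t\<^sup>\<star> * s\<^sup>\<star>) = t\<^sup>\<star> * (s\<^sup>\<star> * s * (t * t\<^sup>\<star>)) * s\<^sup>\<star>" by (simp add: mult.assoc)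
  also have "\<dots> = (t\<^sup>\<star> * t * t\<^sup>\<star>) * (s\<^sup>\<star> * s * s\<^sup>\<star>)" by (simp only: c[symmetric]) (simp add: mult.assoc)
  finally show "t\<^sup>\<star> * s\<^sup>\<star> * (s * t) * (t\<^sup>\<star> * s\<^sup>\<star>) = t\<^sup>\<star> * s\<^sup>\<star>" by (simp add: sinv_mult_sinv)
qed

lemma natural_leD: "s \<preceq> t \<Longrightarrow> t * (s\<^sup>\<star> * s) = s"
  by (simp add: natural_le_def mult.assoc)

lemma
  fixes e s :: "'s::inverse_semigroup"
  assumes e: "e \<in> idempotents"
  shows idempotent_conjugate: "s\<^sup>\<star> * e * s \<in> idempotents"
    and mult_conjugate: "s * (s\<^sup>\<star> * e * s) = e * s"
proof -
  show 1: "s * (s\<^sup>\<star> * e * s) = e * s"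
  proof -
    have "s * (s\<^sup>\<star> * e * s) = (s * s\<^sup>\<star> * e) * s" by (simp add: mult.assoc)
    also have "\<dots> = e * (s * s\<^sup>\<star> * s)"
      by (simp only: idempotent_commute[OF idempotent_range e]) (simp add: mult.assoc)
    finally show ?thesis by (simp add: mult_sinv_mult)
  qed
  have "(s\<^sup>\<star> * e * s) * (s\<^sup>\<star> * e * s) = s\<^sup>\<star> * e * (s * (s\<^sup>\<star> * e * s))" by (simp add: mult.assoc)
  also have "\<dots> = s\<^sup>\<star> * (e * e) * s" by (simp only: 1) (simp add: mult.assoc)
  finally show "s\<^sup>\<star> * e * s \<in> idempotents"
    using e by (simp add: idempotents_iff)
qed

lemma natural_leI:
  fixes t :: "'s::inverse_semigroup"
  assumes e: "e \<in> idempotents"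
  shows "t * e \<preceq> t"
proof -
  have "t * (t * e)\<^sup>\<star> * (t * e) = t * ((e * (t\<^sup>\<star> * t)) * e)"
    by (simp add: sinv_mult idempotent_sinv[OF e] mult.assoc)
  also have "\<dots> = (t * t\<^sup>\<star> * t) * (e * e)"
    by (simp only: idempotent_commute[OF e idempotent_source]) (simp add: mult.assoc)
  finally show ?thesis using e by (simp add: natural_le_def mult_sinv_mult idempotents_iff)
qed

lemma natural_le_mult_right:
  fixes s t v :: "'s::inverse_semigroup"
  assumes "s \<preceq> t"
  shows "s * v \<preceq> t * v"
proof -
  have "s * v = (t * v) * (v\<^sup>\<star> * (s\<^sup>\<star> * s) * v)"
    using mult_conjugate[OF idempotent_source, of v s]
    by (simp add: mult.assoc) (metis assms mult.assoc natural_leD)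
  then show ?thesis using natural_leI[OF idempotent_conjugate[OF idempotent_source]] by metis
qed

lemma natural_le_mult_left:
  fixes s u v :: "'s::inverse_semigroup"
  assumes "u \<preceq> v"
  shows "s * u \<preceq> s * v"
  using natural_leI[OF idempotent_source, of "s * v" u] natural_leD[OF assms]
  by (simp add: mult.assoc)

lemma
  fixes s t :: "'s::inverse_semigroup"
  assumes "s \<preceq> t"
  shows natural_le_source: "t\<^sup>\<star> * s = s\<^sup>\<star> * s"
    and natural_le_sinv: "s\<^sup>\<star> = (s\<^sup>\<star> * s) * t\<^sup>\<star>"
    and natural_le_sinv': "t\<^sup>\<star> * (s * s\<^sup>\<star>) = s\<^sup>\<star>"
proof -
  define e where "e = s\<^sup>\<star> * s"
  have e: "e \<in> idempotents" "e * e = e" by (simp_all add: e_def idempotent_source flip: idempotents_iff)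
  have s: "s = t * e" using natural_leD[OF assms] by (simp add: e_def)
  have si: "s\<^sup>\<star> = e * t\<^sup>\<star>" by (subst s) (simp add: sinv_mult idempotent_sinv[OF e(1)])
  then show "s\<^sup>\<star> = (s\<^sup>\<star> * s) * t\<^sup>\<star>" by (simp add: e_def)
  have c: "t\<^sup>\<star> * t * e = e * (t\<^sup>\<star> * t)" by (rule idempotent_commute[OF idempotent_source e(1)])
  have "t\<^sup>\<star> * s = e * (e * (t\<^sup>\<star> * t))" using c e(2) by (subst s) (metis mult.assoc)
  also have "\<dots> = e * (t\<^sup>\<star> * t * e)" by (simp only: c)
  also have "\<dots> = s\<^sup>\<star> * s" by (subst (2) s) (simp add: si mult.assoc)
  finally show ts: "t\<^sup>\<star> * s = s\<^sup>\<star> * s" .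
  show "t\<^sup>\<star> * (s * s\<^sup>\<star>) = s\<^sup>\<star>"
    using ts by (simp add: sinv_mult_sinv flip: mult.assoc)
qed

lemma natural_le_source_mult:
  fixes r s :: "'s::inverse_semigroup"
  assumes "r \<preceq> s"
  shows "(s\<^sup>\<star> * s) * (r\<^sup>\<star> * r) = r\<^sup>\<star> * r"
  using natural_le_source[OF assms] natural_leD[OF assms] by (simp add: mult.assoc)


section \<open>Domains of a twisted action\<close>

context twisted_action
begin

text \<open>The adjoint \<open>\<omega>(s,t)\<^sup>*\<close>. It is a constant of its own so that its ideal \<open>D (s * t)\<close> stays as it is
  when an equation such as \<open>D (s\<^sup>\<star> * s) = D (s\<^sup>\<star>)\<close> is used for rewriting.\<close>

definition upsilon  ("\<upsilon>")
  where "\<upsilon> s t = multiplier_star (D (s * t)) (\<omega> s t)"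

abbreviation beta_inverse  ("\<gamma>")
  where "\<gamma> s \<equiv> \<beta>_inv D \<beta> s"

lemmas D_zero = closed_ideal_zero[OF ideal]
  and D_add = closed_ideal_add[OF ideal]
  and D_scaleC = closed_ideal_scaleC[OF ideal]
  and D_left = closed_ideal_left[OF ideal]
  and D_right = closed_ideal_right[OF ideal]
  and D_star = closed_ideal_star[OF ideal]

lemma inv_iso: "star_isomorphism (D s) (D (s\<^sup>\<star>)) (\<gamma> s)"
  unfolding \<beta>_inv_def by (rule star_isomorphism_inv[OF ideal iso])

lemma
  shows beta_mem: "x \<in> D (s\<^sup>\<star>) \<Longrightarrow> \<beta> s x \<in> D s"
    and beta_add: "x \<in> D (s\<^sup>\<star>) \<Longrightarrow> y \<in> D (s\<^sup>\<star>) \<Longrightarrow> \<beta> s (x + y) = \<beta> s x + \<beta> s y"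
    and beta_scaleC: "x \<in> D (s\<^sup>\<star>) \<Longrightarrow> \<beta> s (c *\<^sub>C x) = c *\<^sub>C \<beta> s x"
    and beta_mult: "x \<in> D (s\<^sup>\<star>) \<Longrightarrow> y \<in> D (s\<^sup>\<star>) \<Longrightarrow> \<beta> s (x * y) = \<beta> s x * \<beta> s y"
    and beta_inj: "x \<in> D (s\<^sup>\<star>) \<Longrightarrow> y \<in> D (s\<^sup>\<star>) \<Longrightarrow> \<beta> s x = \<beta> s y \<longleftrightarrow> x = y"
    and norm_beta: "x \<in> D (s\<^sup>\<star>) \<Longrightarrow> norm (\<beta> s x) = norm x"
  using iso[of s] star_isomorphism_norm[OF ideal ideal iso, of x s]
  by (auto simp: star_isomorphism_def linear_on_def bij_betw_def inj_on_def)

lemma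
  shows beta_inv_mem: "x \<in> D s \<Longrightarrow> \<gamma> s x \<in> D (s\<^sup>\<star>)"
    and beta_inv_add: "x \<in> D s \<Longrightarrow> y \<in> D s \<Longrightarrow> \<gamma> s (x + y) = \<gamma> s x + \<gamma> s y"
    and beta_inv_scaleC: "x \<in> D s \<Longrightarrow> \<gamma> s (c *\<^sub>C x) = c *\<^sub>C \<gamma> s x"
    and beta_inv_mult: "x \<in> D s \<Longrightarrow> y \<in> D s \<Longrightarrow> \<gamma> s (x * y) = \<gamma> s x * \<gamma> s y"
    and beta_inv_star: "x \<in> D s \<Longrightarrow> \<gamma> s (x\<^sup>\<dagger>) = (\<gamma> s x)\<^sup>\<dagger>"
    and norm_beta_inv: "x \<in> D s \<Longrightarrow> norm (\<gamma> s x) = norm x"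
  using inv_iso[of s] star_isomorphism_norm[OF ideal ideal inv_iso, of x s]
  by (auto simp: star_isomorphism_def linear_on_def bij_betw_def inj_on_def)

lemma beta_beta_inv: "y \<in> D s \<Longrightarrow> \<beta> s (\<gamma> s y) = y"
  and beta_inv_beta: "x \<in> D (s\<^sup>\<star>) \<Longrightarrow> \<gamma> s (\<beta> s x) = x"
  using iso[of s]
  by (auto simp: \<beta>_inv_def star_isomorphism_def bij_betw_inv_into_right bij_betw_inv_into_left)

lemma omega_mult: "\<omega> s t \<in> multipliers (D (s * t))"
  using unitary by (rule unitary_multiplier_is_multiplier)

lemma upsilon_mult: "\<upsilon> s t \<in> multipliers (D (s * t))"
  unfolding upsilon_def by (rule multiplier_star_mem[OF ideal omega_mult])

lemmas omega_right_mem = multiplier_right_mem[OF omega_mult]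
  and omega_left_mem = multiplier_left_mem[OF omega_mult]
  and upsilon_right_mem = multiplier_right_mem[OF upsilon_mult]
  and upsilon_left_mem = multiplier_left_mem[OF upsilon_mult]
  and omega_right_mem' = multiplier_right_mem_ideal[OF omega_mult ideal ideal]
  and omega_left_mem' = multiplier_left_mem_ideal[OF omega_mult ideal ideal]
  and upsilon_right_mem' = multiplier_right_mem_ideal[OF upsilon_mult ideal ideal]
  and omega_cancel = unitary_cancel[OF ideal unitary, folded upsilon_def]
  and omega_right_assoc = multiplier_right_assoc_any[OF ideal omega_mult]
  and upsilon_right_assoc = multiplier_right_assoc_any[OF ideal upsilon_mult]
  and upsilon_left_assoc = multiplier_left_assoc_any[OF ideal upsilon_mult]
  and omega_left_star = star_unitary_left[OF ideal unitary, folded upsilon_def]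
  and upsilon_right_star =
    star_unitary_right[OF ideal multiplier_star_unitary[OF ideal unitary],
      unfolded multiplier_star_star[OF ideal unitary], folded upsilon_def]
  and upsilon_left_star =
    star_unitary_left[OF ideal multiplier_star_unitary[OF ideal unitary],
      unfolded multiplier_star_star[OF ideal unitary], folded upsilon_def]
  and norm_omega = norm_unitary_right[OF ideal unitary]
  and norm_upsilon = norm_unitary_right[OF ideal multiplier_star_unitary[OF ideal unitary], folded upsilon_def]

lemma omega_right_inj:
  "x \<in> D (s * t) \<Longrightarrow> y \<in> D (s * t) \<Longrightarrow> x \<lhd> \<omega> s t = y \<lhd> \<omega> s t \<Longrightarrow> x = y"
  by (metis omega_cancel(4))

lemma comp_domain: "x \<in> D ((r * s)\<^sup>\<star>) \<longleftrightarrow> x \<in> D (s\<^sup>\<star>) \<and> \<beta> s x \<in> D (r\<^sup>\<star>)"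
  and comp_value: "x \<in> D ((r * s)\<^sup>\<star>) \<Longrightarrow> \<beta> r (\<beta> s x) = Ad (D (r * s)) (\<omega> r s) (\<beta> (r * s) x)"
  using fun_cong[OF comp, of r s x] beta_mem[of x "r * s"]
  by (auto simp: map_comp_def restrict_map_def split: if_splits)

text \<open>The usable form of \<open>\<beta>\<^sub>r \<circ> \<beta>\<^sub>s = Ad\<^bsub>\<omega>(r,s)\<^esub> \<circ> \<beta>\<^sub>r\<^sub>s\<close>: it trades a right multiplication by \<open>\<omega>(r,s)\<close> for a left
  one.\<close>

lemma beta_beta_omega:
  assumes x: "x \<in> D ((r * s)\<^sup>\<star>)"
  shows "\<beta> r (\<beta> s x) \<lhd> \<omega> r s = \<omega> r s \<rhd> \<beta> (r * s) x"
  using comp_value[OF x] omega_left_mem[OF beta_mem[OF x]] by (simp add: Ad_def omega_cancel flip: upsilon_def)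

text \<open>By the composition law \<open>\<beta>\<^sub>s \<circ> \<beta>\<^sub>s\<^sub>*\<close> and \<open>\<beta>\<^sub>s\<^sub>s\<^sub>*\<close> have the same domain; the former has domain \<open>D\<^sub>s\<close>, the
  latter \<open>D\<^sub>s\<^sub>s\<^sub>*\<close>.\<close>

lemma D_range: "D (s * s\<^sup>\<star>) = D s"
proof -
  have "x \<in> D (s * s\<^sup>\<star>) \<longleftrightarrow> x \<in> D s" for x
    using comp_domain[of x s "s\<^sup>\<star>"] beta_mem[of x "s\<^sup>\<star>"] by (auto simp: sinv_mult)
  then show ?thesis by blast
qed

lemma D_source: "D (s\<^sup>\<star> * s) = D (s\<^sup>\<star>)"
  using D_range[of "s\<^sup>\<star>"] by simp

lemma beta_idempotent:
  assumes e: "e \<in> idempotents" and x: "x \<in> D e"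
  shows "\<beta> e x = x"
proof -
  have ee: "e\<^sup>\<star> = e" "e * e = e" using e idempotent_sinv by (auto simp: idempotents_iff)
  have xe: "x \<in> D (e\<^sup>\<star>)" "\<beta> e x \<in> D e" using x beta_mem[of x e] ee by auto
  have "\<beta> e (\<beta> e x) = Ad (D e) (multiplier_one (D e)) (\<beta> e x)"
    using comp_value[of x e e] x normal_idem[OF e e] ee by simp
  also have "\<dots> = \<beta> e x"
    using xe D_star[OF xe(2)]
    by (simp add: Ad_def multiplier_one_left multiplier_star_right star_star)
  finally show ?thesis using beta_inj[of "\<beta> e x" e x] xe ee by simp
qed

text \<open>Every \<open>z \<in> D\<^sub>r\<^sub>s\<close> is in the range of \<open>Ad\<^bsub>\<omega>(r,s)\<^esub> \<circ> \<beta>\<^sub>r\<^sub>s\<close>, which is the range of \<open>\<beta>\<^sub>r \<circ> \<beta>\<^sub>s\<close>. This gives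
  \<open>\<beta>\<^sub>r(D\<^sub>r\<^sub>* \<inter> D\<^sub>s) = D\<^sub>r\<^sub>s\<close>, which decides in which domains the elements of the later computations lie.\<close>

lemma D_mult_ex:
  assumes z: "z \<in> D (r * s)"
  obtains x where "x \<in> D ((r * s)\<^sup>\<star>)" "x \<in> D (s\<^sup>\<star>)" "\<beta> s x \<in> D (r\<^sup>\<star>)" "z = \<beta> r (\<beta> s x)"
proof -
  define y where "y = \<upsilon> r s \<rhd> (z \<lhd> \<omega> r s)"
  have y: "y \<in> D (r * s)" using z by (simp add: y_def upsilon_left_mem omega_right_mem)
  define x where "x = \<gamma> (r * s) y"
  have x: "x \<in> D ((r * s)\<^sup>\<star>)" using y by (simp add: x_def beta_inv_mem)
  have "\<beta> r (\<beta> s x) = Ad (D (r * s)) (\<omega> r s) y"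
    using comp_value[OF x] y by (simp add: x_def beta_beta_inv)
  also have "\<dots> = z" using z by (simp add: Ad_def y_def omega_cancel omega_right_mem flip: upsilon_def)
  finally show thesis using that[OF x] x comp_domain[of x r s] by simp
qed

lemma D_mult_subset: "D (r * s) \<subseteq> D r"
  by (auto elim!: D_mult_ex intro: beta_mem)

lemma D_sinv_mult_subset: "D ((r * s)\<^sup>\<star>) \<subseteq> D (s\<^sup>\<star>)"
  using comp_domain by blast

lemma beta_mem_mult_iff:
  assumes y: "y \<in> D (r\<^sup>\<star>)"
  shows "\<beta> r y \<in> D (r * s) \<longleftrightarrow> y \<in> D s"
proof
  assume "y \<in> D s"
  define x where "x = \<gamma> s y"
  have x: "x \<in> D (s\<^sup>\<star>)" "\<beta> s x = y"
    using \<open>y \<in> D s\<close> by (simp_all add: x_def beta_inv_mem beta_beta_inv)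
  then have rs: "x \<in> D ((r * s)\<^sup>\<star>)" using y by (simp add: comp_domain)
  have "Ad (D (r * s)) (\<omega> r s) (\<beta> (r * s) x) \<in> D (r * s)"
    unfolding Ad_def upsilon_def[symmetric] by (intro upsilon_right_mem omega_left_mem beta_mem rs)
  then show "\<beta> r y \<in> D (r * s)" using comp_value[OF rs] x(2) by simp
next
  assume "\<beta> r y \<in> D (r * s)"
  then obtain x where x: "x \<in> D (s\<^sup>\<star>)" "\<beta> s x \<in> D (r\<^sup>\<star>)" "\<beta> r y = \<beta> r (\<beta> s x)"
    by (rule D_mult_ex)
  then have "y = \<beta> s x" using y by (simp add: beta_inj)
  then show "y \<in> D s" using x beta_mem by simp
qed

lemma beta_mem_mult: "y \<in> D (r\<^sup>\<star>) \<Longrightarrow> y \<in> D s \<Longrightarrow> \<beta> r y \<in> D (r * s)"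
  by (simp add: beta_mem_mult_iff)

lemma beta_inv_mem_mult:
  assumes "z \<in> D (r * s)"
  shows "\<gamma> r z \<in> D (r\<^sup>\<star>)" "\<gamma> r z \<in> D s"
proof -
  have z: "z \<in> D r" using assms D_mult_subset by blast
  then show "\<gamma> r z \<in> D (r\<^sup>\<star>)" by (rule beta_inv_mem)
  then show "\<gamma> r z \<in> D s"
    using beta_mem_mult_iff[of "\<gamma> r z" r s] assms z by (simp add: beta_beta_inv)
qed

lemma D_idempotent_mult:
  assumes e: "e \<in> idempotents"
  shows "D (e * t) = D e \<inter> D t"
proof -
  have "y \<in> D (e * t) \<longleftrightarrow> y \<in> D t" if "y \<in> D e" for y
    using beta_mem_mult_iff[of y e t] beta_idempotent[OF e that] idempotent_sinv[OF e] that by simp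
  then show ?thesis using D_mult_subset[of e t] by blast
qed

lemma D_source_mult: "D (s\<^sup>\<star> * (s * t)) = D (s\<^sup>\<star>) \<inter> D t"
  using D_idempotent_mult[OF idempotent_source, of s t] by (simp add: D_source mult.assoc)

lemma D_mono: "s \<preceq> t \<Longrightarrow> D s \<subseteq> D t"
  using D_mult_subset[of t "s\<^sup>\<star> * s"] by (simp add: natural_leD)

lemma D_sinv_mono: "s \<preceq> t \<Longrightarrow> D (s\<^sup>\<star>) \<subseteq> D (t\<^sup>\<star>)"
  using D_sinv_mult_subset[of "s * s\<^sup>\<star>" t] D_idempotent_mult[OF idempotent_source, of s "t\<^sup>\<star>"]
  by (metis Int_lower2 natural_le_sinv)

lemma omega_source_right: "x \<in> D r \<Longrightarrow> x \<lhd> \<omega> r (r\<^sup>\<star> * r) = x"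
  and omega_range_right: "x \<in> D r \<Longrightarrow> x \<lhd> \<omega> (r * r\<^sup>\<star>) r = x"
  and omega_idempotents_right: "e \<in> idempotents \<Longrightarrow> f \<in> idempotents \<Longrightarrow> x \<in> D (e * f) \<Longrightarrow> x \<lhd> \<omega> e f = x"
  by (simp_all add: normal_right normal_left normal_idem multiplier_one_right)


section \<open>Consequences of the cocycle identity\<close>

text \<open>The cocycle identity for \<open>(s, s\<^sup>*, s)\<close>, whose other two twists are trivial.\<close>

lemma beta_twist:
  assumes x: "x \<in> D (s\<^sup>\<star>)"
  shows "\<beta> s (x \<lhd> \<omega> (s\<^sup>\<star>) s) = \<beta> s x \<lhd> \<omega> s (s\<^sup>\<star>)"
proof -
  have 1: "x \<lhd> \<omega> (s\<^sup>\<star>) s \<in> D (s\<^sup>\<star>)" using omega_right_mem[of x "s\<^sup>\<star>" s] x by (simp add: D_source)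
  have 2: "\<beta> s x \<lhd> \<omega> s (s\<^sup>\<star>) \<in> D s"
    using omega_right_mem[of "\<beta> s x" s "s\<^sup>\<star>"] beta_mem[OF x] by (simp add: D_range)
  show ?thesis
    using cocycle[of x s "s\<^sup>\<star>" s] x beta_mem[OF 1] 2
    by (simp add: D_source omega_source_right omega_range_right)
qed

lemma beta_twist_adj:
  assumes x: "x \<in> D (s\<^sup>\<star>)"
  shows "\<beta> s (x \<lhd> \<upsilon> (s\<^sup>\<star>) s) = \<beta> s x \<lhd> \<upsilon> s (s\<^sup>\<star>)"
proof -
  have 1: "x \<lhd> \<upsilon> (s\<^sup>\<star>) s \<in> D (s\<^sup>\<star>)" using upsilon_right_mem[of x "s\<^sup>\<star>" s] x by (simp add: D_source)
  have "\<beta> s x = \<beta> s (x \<lhd> \<upsilon> (s\<^sup>\<star>) s) \<lhd> \<omega> s (s\<^sup>\<star>)"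
    using beta_twist[OF 1] x by (simp add: D_source omega_cancel)
  then show ?thesis using beta_mem[OF 1] by (simp add: omega_cancel D_range)
qed

lemma beta_beta_twist:
  assumes x: "x \<in> D (s\<^sup>\<star>)"
  shows "\<beta> (s\<^sup>\<star>) (\<beta> s x) \<lhd> \<omega> (s\<^sup>\<star>) s = \<omega> (s\<^sup>\<star>) s \<rhd> x"
  using beta_beta_omega[of x "s\<^sup>\<star>" s] x beta_idempotent[OF idempotent_source, of x s]
  by (simp add: sinv_mult D_source)

text \<open>For \<open>y = a\<^sup>*\<close> the right-hand side is the coefficient of \<open>(a \<delta>\<^sub>s)\<^sup>*\<close>. Its preimage under \<open>\<beta>\<^sub>s\<^sub>*\<close>, which enters
  every product that starts with \<open>(a \<delta>\<^sub>s)\<^sup>*\<close>, is therefore \<open>\<omega>(s,s\<^sup>*)\<^sup>* y\<close>.\<close>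

lemma beta_upsilon:
  assumes y: "y \<in> D s"
  shows "\<beta> (s\<^sup>\<star>) (\<upsilon> s (s\<^sup>\<star>) \<rhd> y) = \<gamma> s y \<lhd> \<upsilon> (s\<^sup>\<star>) s"
proof -
  define z where "z = \<upsilon> s (s\<^sup>\<star>) \<rhd> y"
  have z: "z \<in> D s" using y upsilon_left_mem[of y s "s\<^sup>\<star>"] by (simp add: z_def D_range)
  have bz: "\<beta> (s\<^sup>\<star>) z \<in> D (s\<^sup>\<star>)" using beta_mem[of z "s\<^sup>\<star>"] z by simp
  have "\<beta> s (\<beta> (s\<^sup>\<star>) z) \<lhd> \<omega> s (s\<^sup>\<star>) = y"
    using beta_beta_twist[of z "s\<^sup>\<star>"] z y by (simp add: z_def omega_cancel D_range)
  then have "\<beta> s (\<beta> (s\<^sup>\<star>) z) = \<beta> s (\<gamma> s y) \<lhd> \<upsilon> s (s\<^sup>\<star>)"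
    using beta_mem[OF bz] y by (metis omega_cancel(4) D_range beta_beta_inv)
  also have "\<dots> = \<beta> s (\<gamma> s y \<lhd> \<upsilon> (s\<^sup>\<star>) s)"
    using y by (simp add: beta_twist_adj beta_inv_mem)
  finally show ?thesis
    using bz upsilon_right_mem[of "\<gamma> s y" "s\<^sup>\<star>" s] y
    by (simp add: beta_inj z_def D_source beta_inv_mem)
qed

lemma beta_inv_upsilon:
  assumes y: "y \<in> D s"
  shows "\<gamma> (s\<^sup>\<star>) (\<gamma> s y \<lhd> \<upsilon> (s\<^sup>\<star>) s) = \<upsilon> s (s\<^sup>\<star>) \<rhd> y"
proof -
  have "\<upsilon> s (s\<^sup>\<star>) \<rhd> y \<in> D ((s\<^sup>\<star>)\<^sup>\<star>)" using y upsilon_left_mem[of y s "s\<^sup>\<star>"] by (simp add: D_range)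
  then show ?thesis by (metis beta_upsilon[OF y] beta_inv_beta)
qed

text \<open>The formula \<open>x \<cdot> c = \<beta>\<^sub>t(\<beta>\<^sub>t\<^sup>-\<^sup>1(x) c)\<close> is a right action of \<open>B\<close> on \<open>D\<^sub>t\<close>. It commutes with left
  multiplication by \<open>D\<^sub>t\<close>, hence also with left multipliers.\<close>

lemma beta_act_left_mult:
  assumes "z \<in> D t" "x \<in> D t"
  shows "z * \<beta> t (\<gamma> t x * c) = \<beta> t (\<gamma> t (z * x) * c)"
  using assms beta_mult[of "\<gamma> t z" t "\<gamma> t x * c"]
  by (simp add: beta_beta_inv beta_inv_mem beta_inv_mult D_right mult.assoc)

lemma beta_act_left_multiplier:
  assumes w: "w \<in> multipliers (D (t * e))" and x: "x \<in> D (t * e)"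
  shows "\<beta> t (\<gamma> t (w \<rhd> x) * c) = w \<rhd> \<beta> t (\<gamma> t x * c)"
proof (rule closed_ideal_eqI_mult_left[OF ideal])
  have act: "\<beta> t (\<gamma> t y * c) \<in> D (t * e)" if "y \<in> D (t * e)" for y
    using beta_inv_mem_mult[OF that] by (intro beta_mem_mult D_right)
  have wx: "w \<rhd> x \<in> D (t * e)" using w x by (rule multiplier_left_mem)
  show "\<beta> t (\<gamma> t (w \<rhd> x) * c) \<in> D (t * e)" "w \<rhd> \<beta> t (\<gamma> t x * c) \<in> D (t * e)"
    using act[OF wx] multiplier_left_mem[OF w act[OF x]] by auto
  fix z assume z: "z \<in> D (t * e)"
  have zw: "z \<lhd> w \<in> D (t * e)" using w z by (rule multiplier_right_mem)
  have t: "z \<in> D t" "x \<in> D t" "w \<rhd> x \<in> D t" "z \<lhd> w \<in> D t"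
    using z x wx zw D_mult_subset by blast+
  have "z * \<beta> t (\<gamma> t (w \<rhd> x) * c) = \<beta> t (\<gamma> t ((z \<lhd> w) * x) * c)"
    using t z x by (simp add: beta_act_left_mult multiplier_middle_assoc[OF w])
  also have "\<dots> = (z \<lhd> w) * \<beta> t (\<gamma> t x * c)" using t by (simp add: beta_act_left_mult)
  also have "\<dots> = z * (w \<rhd> \<beta> t (\<gamma> t x * c))"
    using z act[OF x] by (simp add: multiplier_middle_assoc[OF w])
  finally show "z * \<beta> t (\<gamma> t (w \<rhd> x) * c) = z * (w \<rhd> \<beta> t (\<gamma> t x * c))" .
qed

text \<open>Associativity up to its last twist. Both sides are compared after multiplication on the
  right by \<open>\<beta>\<^sub>r\<^sub>s(x)\<close>, where the composition law moves \<open>\<omega>(r,s)\<close> out of the way.\<close>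

lemma beta_act_comp:
  assumes p: "p \<in> D (r\<^sup>\<star>)" and q: "q \<in> D (s\<^sup>\<star>)"
  shows "\<beta> (r * s) (\<gamma> (r * s) (\<beta> r (p * \<beta> s q) \<lhd> \<omega> r s) * c) = \<beta> r (p * \<beta> s (q * c)) \<lhd> \<omega> r s"
proof (rule closed_ideal_eqI_mult_right[OF ideal])
  have mem: "\<beta> r (p * \<beta> s q') \<in> D (r * s)" if "q' \<in> D (s\<^sup>\<star>)" for q'
    using that p by (intro beta_mem_mult D_left[OF beta_mem] D_right)
  have qc: "q * c' \<in> D (s\<^sup>\<star>)" for c' using q by (rule D_right)
  define m where "m = \<beta> r (p * \<beta> s q) \<lhd> \<omega> r s"
  have m: "m \<in> D (r * s)" using mem[OF q] by (simp add: m_def omega_right_mem)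
  then have gm: "\<gamma> (r * s) m * c \<in> D ((r * s)\<^sup>\<star>)" by (intro D_right beta_inv_mem)
  show "\<beta> (r * s) (\<gamma> (r * s) (\<beta> r (p * \<beta> s q) \<lhd> \<omega> r s) * c) \<in> D (r * s)"
    using beta_mem[OF gm] by (simp add: m_def)
  show R: "\<beta> r (p * \<beta> s (q * c)) \<lhd> \<omega> r s \<in> D (r * s)" by (intro omega_right_mem mem qc)
  fix z assume "z \<in> D (r * s)"
  then obtain x where x: "x \<in> D ((r * s)\<^sup>\<star>)" and z: "z = \<beta> (r * s) x"
    using beta_beta_inv beta_inv_mem by metis
  have key: "(\<beta> r (p * \<beta> s q') \<lhd> \<omega> r s) * \<beta> (r * s) y = \<beta> r (p * \<beta> s (q' * y)) \<lhd> \<omega> r s"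
    if q': "q' \<in> D (s\<^sup>\<star>)" and y: "y \<in> D ((r * s)\<^sup>\<star>)" for q' y
  proof -
    have ys: "y \<in> D (s\<^sup>\<star>)" "\<beta> s y \<in> D (r\<^sup>\<star>)" using y comp_domain by auto
    have by_mem: "\<beta> r (\<beta> s y) \<in> D (r * s)" using ys beta_mem by (intro beta_mem_mult) auto
    have "(\<beta> r (p * \<beta> s q') \<lhd> \<omega> r s) * \<beta> (r * s) y = \<beta> r (p * \<beta> s q') * (\<omega> r s \<rhd> \<beta> (r * s) y)"
      using mem[OF q'] beta_mem[OF y] by (simp add: multiplier_middle_assoc[OF omega_mult])
    also have "\<dots> = \<beta> r (p * \<beta> s q') * (\<beta> r (\<beta> s y) \<lhd> \<omega> r s)" using y by (simp add: beta_beta_omega)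
    also have "\<dots> = (\<beta> r (p * \<beta> s q') * \<beta> r (\<beta> s y)) \<lhd> \<omega> r s"
      using by_mem by (simp add: omega_right_assoc)
    also have "\<beta> r (p * \<beta> s q') * \<beta> r (\<beta> s y) = \<beta> r (p * \<beta> s (q' * y))"
      using p q' ys by (simp add: D_right mult.assoc flip: beta_mult)
    finally show ?thesis .
  qed
  have cx: "c * x \<in> D ((r * s)\<^sup>\<star>)" using x by (rule D_left)
  have "\<beta> (r * s) (\<gamma> (r * s) m * c) * z = \<beta> (r * s) (\<gamma> (r * s) m * (c * x))"
    using gm x by (simp add: z mult.assoc flip: beta_mult)
  also have "\<dots> = m * \<beta> (r * s) (c * x)"
    using m cx by (simp add: beta_mult beta_inv_mem beta_beta_inv)
  also have "\<dots> = \<beta> r (p * \<beta> s (q * (c * x))) \<lhd> \<omega> r s" using key[OF q cx] by (simp add: m_def)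
  also have "\<dots> = (\<beta> r (p * \<beta> s (q * c)) \<lhd> \<omega> r s) * z" using key[OF qc x] by (simp add: z mult.assoc)
  finally show "\<beta> (r * s) (\<gamma> (r * s) (\<beta> r (p * \<beta> s q) \<lhd> \<omega> r s) * c) * z =
    (\<beta> r (p * \<beta> s (q * c)) \<lhd> \<omega> r s) * z" by (simp add: m_def)
qed

text \<open>Turns the normalisation of mixed twists, a statement about left multiplication, into one about
  right multiplication, which is the side the cocycle identity speaks about.\<close>

lemma normal_mixed_right:
  assumes e: "e \<in> idempotents" and x: "x \<in> D (s\<^sup>\<star> * (e * s))"
  shows "x \<lhd> \<omega> (s\<^sup>\<star>) e \<lhd> \<omega> (s\<^sup>\<star> * e) s = x \<lhd> \<omega> (s\<^sup>\<star>) s"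
proof (rule closed_ideal_eqI_mult_right[OF ideal])
  have sub: "y \<in> D (s\<^sup>\<star> * e)" "y \<in> D (s\<^sup>\<star> * e * s)" "y \<in> D (s\<^sup>\<star> * s)"
    if "y \<in> D (s\<^sup>\<star> * (e * s))" for y
    using that D_mult_subset[of "s\<^sup>\<star> * e" s] D_mult_subset[of "s\<^sup>\<star>" "e * s"] D_source[of s]
    by (auto simp: mult.assoc)
  note mem = omega_right_mem'[OF sub(1)] omega_right_mem'[OF sub(2)] omega_right_mem'[OF sub(3)]
  have x1: "x \<lhd> \<omega> (s\<^sup>\<star>) e \<in> D (s\<^sup>\<star> * (e * s))" using x by (intro mem)
  show "x \<lhd> \<omega> (s\<^sup>\<star>) e \<lhd> \<omega> (s\<^sup>\<star> * e) s \<in> D (s\<^sup>\<star> * (e * s))" using x by (intro mem)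
  show "x \<lhd> \<omega> (s\<^sup>\<star>) s \<in> D (s\<^sup>\<star> * (e * s))" using x by (intro mem)
  fix y assume y: "y \<in> D (s\<^sup>\<star> * (e * s))"
  have y1: "\<omega> (s\<^sup>\<star> * e) s \<rhd> y \<in> D (s\<^sup>\<star> * e)" by (intro omega_left_mem' sub[OF y])
  have "(x \<lhd> \<omega> (s\<^sup>\<star>) e \<lhd> \<omega> (s\<^sup>\<star> * e) s) * y = x * (\<omega> (s\<^sup>\<star>) e \<rhd> \<omega> (s\<^sup>\<star> * e) s \<rhd> y)"
    using sub[OF x] sub[OF x1] sub[OF y] y1
    by (simp add: multiplier_middle_assoc[OF omega_mult])
  also have "\<dots> = x * (\<omega> (s\<^sup>\<star>) s \<rhd> y)" using normal_mixed[OF e, of y s] y by (simp add: mult.assoc)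
  also have "\<dots> = (x \<lhd> \<omega> (s\<^sup>\<star>) s) * y"
    using sub[OF x] sub[OF y] by (simp add: multiplier_middle_assoc[OF omega_mult])
  finally show "(x \<lhd> \<omega> (s\<^sup>\<star>) e \<lhd> \<omega> (s\<^sup>\<star> * e) s) * y = (x \<lhd> \<omega> (s\<^sup>\<star>) s) * y" .
qed

text \<open>The identity behind \<open>(\<xi> \<eta>)\<^sup>* = \<eta>\<^sup>* \<xi>\<^sup>*\<close>. With \<open>x = \<beta>\<^sub>s\<^sub>*(y)\<close>, \<open>Y = \<beta>\<^sub>t\<^sub>*\<^sub>s\<^sub>*(y)\<close> and \<open>e = s\<^sup>* s\<close>, the cocycle identity
  for \<open>(t\<^sup>*, s\<^sup>*, s)\<close> followed by \<open>\<omega>(t\<^sup>* e, t)\<close>, and the one for \<open>(t\<^sup>* s\<^sup>*, s, t)\<close> preceded by \<open>\<omega>(t\<^sup>*, s\<^sup>*)\<close>,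
  have the common middle term \<open>\<omega>(t\<^sup>*, s\<^sup>*) Y \<omega>(t\<^sup>* s\<^sup>*, s) \<omega>(t\<^sup>* e, t)\<close>; the mixed normalisation contracts
  \<open>\<omega>(t\<^sup>*, e) \<omega>(t\<^sup>* e, t)\<close> to \<open>\<omega>(t\<^sup>*, t)\<close>.\<close>

lemma twist_sinv_mult:
  assumes y: "y \<in> D (s * t)"
  shows "\<beta> (t\<^sup>\<star>) (\<beta> (s\<^sup>\<star>) y \<lhd> \<omega> (s\<^sup>\<star>) s) \<lhd> \<omega> (t\<^sup>\<star>) t =
    \<omega> (t\<^sup>\<star>) (s\<^sup>\<star>) \<rhd> (\<beta> (t\<^sup>\<star> * s\<^sup>\<star>) (y \<lhd> \<omega> s t) \<lhd> \<omega> (t\<^sup>\<star> * s\<^sup>\<star>) (s * t))"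
proof -
  define e where "e = s\<^sup>\<star> * s"
  have e: "e \<in> idempotents" by (simp add: e_def idempotent_source)
  define x where "x = \<beta> (s\<^sup>\<star>) y"
  have ys: "y \<in> D s" "y \<in> D ((s\<^sup>\<star>)\<^sup>\<star>)" using y D_mult_subset by auto
  have "x \<in> D (s\<^sup>\<star> * (s * t))" unfolding x_def using ys y by (intro beta_mem_mult) auto
  then have x: "x \<in> D (s\<^sup>\<star>)" "x \<in> D t" "x \<in> D (s\<^sup>\<star> * s)" by (auto simp: D_source_mult D_source)
  have xe: "x \<lhd> \<omega> (s\<^sup>\<star>) s \<in> D e" "x \<lhd> \<omega> (s\<^sup>\<star>) s \<in> D t"
    using x by (auto simp: e_def intro: omega_right_mem' omega_right_mem)
  define X where "X = \<beta> (t\<^sup>\<star>) (x \<lhd> \<omega> (s\<^sup>\<star>) s)"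
  have X: "X \<in> D (t\<^sup>\<star> * (e * t))"
    unfolding X_def using xe by (intro beta_mem_mult) (auto simp: D_idempotent_mult[OF e])
  define Y where "Y = \<beta> (t\<^sup>\<star> * s\<^sup>\<star>) y"
  have y': "y \<in> D ((t\<^sup>\<star> * s\<^sup>\<star>)\<^sup>\<star>)" using y by (simp add: sinv_mult)
  have Y: "Y \<in> D (t\<^sup>\<star> * s\<^sup>\<star>)" "Y \<in> D (t\<^sup>\<star> * s\<^sup>\<star> * s)" "Y \<in> D (t\<^sup>\<star> * s\<^sup>\<star> * s * t)"
    using beta_mem[OF y'] beta_mem_mult[OF y' ys(1)] beta_mem_mult[OF y' y]
    by (simp_all add: Y_def mult.assoc)
  have Y1: "Y \<lhd> \<omega> (t\<^sup>\<star> * s\<^sup>\<star>) s \<in> D (t\<^sup>\<star> * s\<^sup>\<star>)"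
    "Y \<lhd> \<omega> (t\<^sup>\<star> * s\<^sup>\<star>) s \<in> D (t\<^sup>\<star> * s\<^sup>\<star> * s * t)"
    using Y by (auto intro: omega_right_mem')
  have "X \<lhd> \<omega> (t\<^sup>\<star>) e = \<beta> (t\<^sup>\<star>) x \<lhd> \<omega> (t\<^sup>\<star>) (s\<^sup>\<star>) \<lhd> \<omega> (t\<^sup>\<star> * s\<^sup>\<star>) s"
    using cocycle[of x "t\<^sup>\<star>" "s\<^sup>\<star>" s] x by (simp add: X_def e_def)
  also have "\<beta> (t\<^sup>\<star>) x \<lhd> \<omega> (t\<^sup>\<star>) (s\<^sup>\<star>) = \<omega> (t\<^sup>\<star>) (s\<^sup>\<star>) \<rhd> Y"
    using beta_beta_omega[OF y'] by (simp add: x_def Y_def)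
  also have "(\<omega> (t\<^sup>\<star>) (s\<^sup>\<star>) \<rhd> Y) \<lhd> \<omega> (t\<^sup>\<star> * s\<^sup>\<star>) s = \<omega> (t\<^sup>\<star>) (s\<^sup>\<star>) \<rhd> (Y \<lhd> \<omega> (t\<^sup>\<star> * s\<^sup>\<star>) s)"
    using Y by (intro multiplier_left_right_commute[OF ideal omega_mult ideal omega_mult])
  finally have 1: "X \<lhd> \<omega> (t\<^sup>\<star>) e = \<omega> (t\<^sup>\<star>) (s\<^sup>\<star>) \<rhd> (Y \<lhd> \<omega> (t\<^sup>\<star> * s\<^sup>\<star>) s)" .
  have "X \<lhd> \<omega> (t\<^sup>\<star>) t = X \<lhd> \<omega> (t\<^sup>\<star>) e \<lhd> \<omega> (t\<^sup>\<star> * e) t"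
    using normal_mixed_right[OF e X] by simp
  also have "\<dots> = (\<omega> (t\<^sup>\<star>) (s\<^sup>\<star>) \<rhd> (Y \<lhd> \<omega> (t\<^sup>\<star> * s\<^sup>\<star>) s)) \<lhd> \<omega> (t\<^sup>\<star> * s\<^sup>\<star> * s) t"
    by (simp add: 1) (simp add: e_def mult.assoc)
  also have "\<dots> = \<omega> (t\<^sup>\<star>) (s\<^sup>\<star>) \<rhd> (Y \<lhd> \<omega> (t\<^sup>\<star> * s\<^sup>\<star>) s \<lhd> \<omega> (t\<^sup>\<star> * s\<^sup>\<star> * s) t)"
    using Y1 by (intro multiplier_left_right_commute[OF ideal omega_mult ideal omega_mult])
  also have "Y \<lhd> \<omega> (t\<^sup>\<star> * s\<^sup>\<star>) s \<lhd> \<omega> (t\<^sup>\<star> * s\<^sup>\<star> * s) t =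
      \<beta> (t\<^sup>\<star> * s\<^sup>\<star>) (y \<lhd> \<omega> s t) \<lhd> \<omega> (t\<^sup>\<star> * s\<^sup>\<star>) (s * t)"
    using cocycle[of y "t\<^sup>\<star> * s\<^sup>\<star>" s t] y y' by (simp add: Y_def)
  finally show ?thesis by (simp add: X_def x_def)
qed

text \<open>The adjoint of the preceding identity for \<open>\<beta>\<^sub>s(y)\<close> in place of \<open>y\<close>, rewritten with the inverse maps.
  For \<open>y = \<beta>\<^sub>s\<^sup>-\<^sup>1(a) b\<close> the two sides are the coefficients of \<open>((a \<delta>\<^sub>s)(b \<delta>\<^sub>t))\<^sup>*\<close> and
  \<open>(b \<delta>\<^sub>t)\<^sup>* (a \<delta>\<^sub>s)\<^sup>*\<close>.\<close>

lemma twist_star_mult: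
  assumes y: "y \<in> D (s\<^sup>\<star>)" "y \<in> D t"
  shows "\<gamma> (s * t) ((\<beta> s y \<lhd> \<omega> s t)\<^sup>\<dagger>) \<lhd> \<upsilon> ((s * t)\<^sup>\<star>) (s * t) =
    \<gamma> t (y\<^sup>\<dagger> \<lhd> \<upsilon> (s\<^sup>\<star>) s) \<lhd> \<upsilon> (t\<^sup>\<star>) t \<lhd> \<omega> (t\<^sup>\<star>) (s\<^sup>\<star>)"
proof -
  define n where "n = \<beta> s y \<lhd> \<omega> s t"
  have bs: "\<beta> s y \<in> D (s * t)" using y by (rule beta_mem_mult)
  then have n: "n \<in> D (s * t)" by (simp add: n_def omega_right_mem)
  define g where "g = \<gamma> (s * t) n"
  have g: "g \<in> D ((s * t)\<^sup>\<star>)" using n by (simp add: g_def beta_inv_mem)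
  define y1 where "y1 = \<omega> (s\<^sup>\<star>) s \<rhd> y"
  have y1: "y1 \<in> D t" using y by (auto simp: y1_def D_source intro!: omega_left_mem')
  define h where "h = \<gamma> t y1"
  have h: "h \<in> D (t\<^sup>\<star>)" using y1 by (simp add: h_def beta_inv_mem)
  have st: "D ((s * t)\<^sup>\<star> * (s * t)) = D (t\<^sup>\<star> * s\<^sup>\<star>)" using D_source[of "s * t"] by (simp add: sinv_mult)
  have lh: "\<omega> (t\<^sup>\<star>) t \<rhd> h = \<omega> (t\<^sup>\<star>) (s\<^sup>\<star>) \<rhd> \<omega> ((s * t)\<^sup>\<star>) (s * t) \<rhd> g"
  proof -
    have "\<omega> (t\<^sup>\<star>) t \<rhd> h = \<beta> (t\<^sup>\<star>) y1 \<lhd> \<omega> (t\<^sup>\<star>) t"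
      using beta_beta_twist[OF h] y1 by (simp add: h_def beta_beta_inv)
    also have "y1 = \<beta> (s\<^sup>\<star>) (\<beta> s y) \<lhd> \<omega> (s\<^sup>\<star>) s"
      using beta_beta_twist[OF y(1)] by (simp add: y1_def)
    finally have "\<omega> (t\<^sup>\<star>) t \<rhd> h = \<omega> (t\<^sup>\<star>) (s\<^sup>\<star>) \<rhd>
        (\<beta> ((s * t)\<^sup>\<star>) n \<lhd> \<omega> ((s * t)\<^sup>\<star>) (s * t))"
      using twist_sinv_mult[OF bs] by (simp add: n_def sinv_mult)
    then show ?thesis
      using beta_beta_twist[OF g] n by (simp add: g_def beta_beta_inv)
  qed
  have wg: "\<omega> ((s * t)\<^sup>\<star>) (s * t) \<rhd> g \<in> D (t\<^sup>\<star> * s\<^sup>\<star>)"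
    using omega_left_mem[of g "(s * t)\<^sup>\<star>" "s * t"] g st by (simp add: sinv_mult)
  have h': "\<omega> (t\<^sup>\<star>) t \<rhd> h \<in> D (t\<^sup>\<star> * s\<^sup>\<star>)"
    unfolding lh using wg by (rule omega_left_mem)
  have "\<upsilon> (t\<^sup>\<star>) (s\<^sup>\<star>) \<rhd> \<omega> (t\<^sup>\<star>) t \<rhd> h = \<omega> ((s * t)\<^sup>\<star>) (s * t) \<rhd> g"
    unfolding lh using wg by (simp add: omega_cancel)
  then have "(\<upsilon> (t\<^sup>\<star>) (s\<^sup>\<star>) \<rhd> \<omega> (t\<^sup>\<star>) t \<rhd> h)\<^sup>\<dagger> = (\<omega> ((s * t)\<^sup>\<star>) (s * t) \<rhd> g)\<^sup>\<dagger>" by simp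
  moreover have "(\<upsilon> (t\<^sup>\<star>) (s\<^sup>\<star>) \<rhd> \<omega> (t\<^sup>\<star>) t \<rhd> h)\<^sup>\<dagger> = h\<^sup>\<dagger> \<lhd> \<upsilon> (t\<^sup>\<star>) t \<lhd> \<omega> (t\<^sup>\<star>) (s\<^sup>\<star>)"
    using h' h by (simp add: upsilon_left_star omega_left_star D_source)
  moreover have "(\<omega> ((s * t)\<^sup>\<star>) (s * t) \<rhd> g)\<^sup>\<dagger> = g\<^sup>\<dagger> \<lhd> \<upsilon> ((s * t)\<^sup>\<star>) (s * t)"
    using g by (intro omega_left_star) (simp add: D_source)
  moreover have "h\<^sup>\<dagger> = \<gamma> t (y\<^sup>\<dagger> \<lhd> \<upsilon> (s\<^sup>\<star>) s)"
    using y y1 by (simp add: h_def omega_left_star y1_def D_source flip: beta_inv_star)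
  moreover have "g\<^sup>\<dagger> = \<gamma> (s * t) (n\<^sup>\<dagger>)" using n by (simp add: g_def beta_inv_star)
  ultimately show ?thesis by (simp add: n_def)
qed

text \<open>The cocycle identity for \<open>(t, e, f)\<close>; it makes restriction transitive.\<close>

lemma omega_idempotent_mult:
  assumes e: "e \<in> idempotents" and f: "f \<in> idempotents" and z: "z \<in> D (t * (e * f))"
  shows "z \<lhd> \<omega> t (e * f) = z \<lhd> \<omega> t e \<lhd> \<omega> (t * e) f"
  using cocycle[of "\<gamma> t z" t e f] beta_inv_mem_mult[OF z] z D_mult_subset[of t "e * f"]
  by (auto simp: omega_idempotents_right[OF e f] beta_beta_inv)

text \<open>So \<open>\<omega>(t,f)\<close> depends only on the product \<open>r = t f\<close>. The idempotent \<open>g = r\<^sup>* r\<close> lies below \<open>f\<close>, so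
  \<open>\<omega>(t,g) = \<omega>(t,f) \<omega>(r,g)\<close>, and \<open>\<omega>(r,r\<^sup>* r) = 1\<close>.\<close>

lemma omega_right_cong:
  assumes f: "f \<in> idempotents" and z: "z \<in> D (t * f)"
  shows "z \<lhd> \<omega> t f = z \<lhd> \<omega> t ((t * f)\<^sup>\<star> * (t * f))"
proof -
  define r g where "r = t * f" and "g = r\<^sup>\<star> * r"
  have fg: "f * g = g"
    using f by (simp add: g_def r_def sinv_mult idempotent_sinv idempotents_iff flip: mult.assoc)
  have g: "g \<in> idempotents" by (simp add: g_def idempotent_source)
  have "t * (f * g) = r * (r\<^sup>\<star> * r)" by (simp add: g_def r_def mult.assoc)
  then have "t * (f * g) = r" by (simp add: mult_sinv_mult')
  then have "z \<lhd> \<omega> t (f * g) = z \<lhd> \<omega> t f \<lhd> \<omega> r g"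
    using omega_idempotent_mult[OF f g, of z t] z by (simp add: r_def)
  also have "\<dots> = z \<lhd> \<omega> t f"
    unfolding g_def using omega_right_mem[OF z] by (intro omega_source_right) (simp add: r_def)
  finally show ?thesis by (simp add: fg) (simp add: g_def r_def)
qed

text \<open>An idempotent can be moved from the left of \<open>s\<close> to its right, since \<open>e s = s (s\<^sup>* e s)\<close>,
  and the twist does not change. When \<open>\<beta>\<^sub>s\<^sub>*\<close> and then \<open>\<omega>(s\<^sup>*, e s)\<close> are applied, both sides become
  \<open>\<beta>\<^sub>s\<^sub>*(x) \<omega>(s\<^sup>*, s)\<close>: the left one by the cocycle identity for \<open>(s\<^sup>*, e, s)\<close> and the mixed normalisation,
  the right one by the cocycle identity for \<open>(s\<^sup>*, s, s\<^sup>* e s)\<close>.\<close>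

lemma omega_idempotent_left:
  assumes e: "e \<in> idempotents" and x: "x \<in> D (e * s)"
  shows "x \<lhd> \<omega> e s = x \<lhd> \<omega> s (s\<^sup>\<star> * e * s)"
proof -
  define h where "h = s\<^sup>\<star> * e * s"
  have h: "h \<in> idempotents" and sh: "s * h = e * s"
    by (simp_all add: h_def idempotent_conjugate[OF e] mult_conjugate[OF e])
  have xs: "x \<in> D s" "x \<in> D ((s\<^sup>\<star>)\<^sup>\<star>)" using x D_idempotent_mult[OF e] by auto
  define X where "X = \<beta> (s\<^sup>\<star>) x"
  have X: "X \<in> D (s\<^sup>\<star> * (e * s))" unfolding X_def using xs x by (intro beta_mem_mult)
  have Xs: "X \<in> D (s\<^sup>\<star> * s)" using beta_mem[OF xs(2)] by (simp add: X_def D_source)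
  have mem: "x \<lhd> \<omega> e s \<in> D (e * s)" "x \<lhd> \<omega> e s \<in> D ((s\<^sup>\<star>)\<^sup>\<star>)"
    "x \<lhd> \<omega> s h \<in> D (e * s)" "x \<lhd> \<omega> s h \<in> D ((s\<^sup>\<star>)\<^sup>\<star>)"
    using x xs by (auto simp: sh intro!: omega_right_mem')
  have "\<beta> (s\<^sup>\<star>) (x \<lhd> \<omega> e s) \<lhd> \<omega> (s\<^sup>\<star>) (e * s) = X \<lhd> \<omega> (s\<^sup>\<star>) e \<lhd> \<omega> (s\<^sup>\<star> * e) s"
    using cocycle[of x "s\<^sup>\<star>" e s] x xs by (simp add: X_def)
  also have "\<dots> = X \<lhd> \<omega> (s\<^sup>\<star>) s" by (rule normal_mixed_right[OF e X])
  also have "\<dots> = X \<lhd> \<omega> (s\<^sup>\<star>) s \<lhd> \<omega> (s\<^sup>\<star> * s) h"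
    using omega_right_mem'[OF Xs X] sh
    by (intro omega_idempotents_right[symmetric] idempotent_source h) (simp add: mult.assoc)
  also have "\<dots> = \<beta> (s\<^sup>\<star>) (x \<lhd> \<omega> s h) \<lhd> \<omega> (s\<^sup>\<star>) (e * s)"
    using cocycle[of x "s\<^sup>\<star>" s h] x xs by (simp add: X_def sh)
  finally have "\<beta> (s\<^sup>\<star>) (x \<lhd> \<omega> e s) = \<beta> (s\<^sup>\<star>) (x \<lhd> \<omega> s h)"
    by (rule omega_right_inj[rotated 2]) (intro beta_mem_mult mem)+
  then show ?thesis using mem by (simp add: beta_inj h_def)
qed

text \<open>The cocycle identities for \<open>(t, u, u\<^sup>* e u)\<close> and \<open>(t, e, u)\<close> have equal left-hand sides,
  since \<open>u u\<^sup>* e u = e u\<close> and \<open>\<omega>(u, u\<^sup>* e u) = \<omega>(e, u)\<close>.\<close>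

lemma omega_restrict_left:
  assumes e: "e \<in> idempotents" and z: "z \<in> D (t * (e * u))"
  shows "z \<lhd> \<omega> t u \<lhd> \<omega> (t * u) (u\<^sup>\<star> * e * u) = z \<lhd> \<omega> t e \<lhd> \<omega> (t * e) u"
proof -
  define h where "h = u\<^sup>\<star> * e * u"
  have uh: "u * h = e * u" by (simp add: h_def mult_conjugate[OF e])
  note x = beta_inv_mem_mult[OF z]
  have zt: "\<beta> t (\<gamma> t z) = z" using z D_mult_subset by (blast intro: beta_beta_inv)
  have "z \<lhd> \<omega> t u \<lhd> \<omega> (t * u) h = \<beta> t (\<gamma> t z \<lhd> \<omega> u h) \<lhd> \<omega> t (e * u)"
    using cocycle[of "\<gamma> t z" t u h] x by (simp add: uh zt)
  also have "\<gamma> t z \<lhd> \<omega> u h = \<gamma> t z \<lhd> \<omega> e u"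
    using omega_idempotent_left[OF e x(2)] by (simp add: h_def)
  also have "\<beta> t (\<gamma> t z \<lhd> \<omega> e u) \<lhd> \<omega> t (e * u) = z \<lhd> \<omega> t e \<lhd> \<omega> (t * e) u"
    using cocycle[of "\<gamma> t z" t e u] x by (simp add: zt)
  finally show ?thesis by (simp add: h_def)
qed

lemma upsilon_trans:
  assumes rs: "r \<preceq> s" and st: "s \<preceq> t" and z: "z \<in> D r"
  shows "z \<lhd> \<upsilon> t (r\<^sup>\<star> * r) = z \<lhd> \<upsilon> s (r\<^sup>\<star> * r) \<lhd> \<upsilon> t (s\<^sup>\<star> * s)"
proof -
  define e f where "e = s\<^sup>\<star> * s" and "f = r\<^sup>\<star> * r"
  have idem: "e \<in> idempotents" "f \<in> idempotents" by (simp_all add: e_def f_def idempotent_source)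
  have te: "t * e = s" and sf: "s * f = r" and ef: "e * f = f"
    using natural_leD[OF rs] natural_leD[OF st] natural_le_source_mult[OF rs]
    by (simp_all add: e_def f_def)
  have tf: "t * f = r" using te sf ef by (metis mult.assoc)
  define y where "y = z \<lhd> \<upsilon> t f"
  have y: "y \<in> D r" using upsilon_right_mem[of z t f] z tf by (simp add: y_def)
  then have ys: "y \<in> D s" using D_mono[OF rs] by blast
  have y1: "y \<lhd> \<omega> t e \<in> D r" by (rule omega_right_mem') (simp_all add: te y ys)
  have "z = y \<lhd> \<omega> t (e * f)" using z by (simp add: y_def omega_cancel tf ef)
  also have "\<dots> = y \<lhd> \<omega> t e \<lhd> \<omega> s f"
    using omega_idempotent_mult[OF idem, of y t] y by (simp add: te ef tf)
  finally have "z \<lhd> \<upsilon> s f \<lhd> \<upsilon> t e = y"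
    using y1 ys by (simp add: omega_cancel sf te)
  then show ?thesis by (simp add: y_def e_def f_def)
qed

lemma beta_restrict:
  assumes st: "s \<preceq> t" and x: "x \<in> D (s\<^sup>\<star>)"
  shows "\<beta> t x \<lhd> \<omega> t (s\<^sup>\<star> * s) = \<omega> t (s\<^sup>\<star> * s) \<rhd> \<beta> s x"
  using beta_beta_omega[of x t "s\<^sup>\<star> * s"] x beta_idempotent[OF idempotent_source, of x s]
  by (simp add: natural_leD[OF st] D_source)

text \<open>Let \<open>f = u\<^sup>* u\<close>. The cocycle identity for \<open>(s, v, f)\<close> moves \<open>\<omega>(v,f)\<^sup>*\<close> past \<open>\<omega>(s,v)\<close>, where it becomes
  \<open>\<omega>(s v,f)\<^sup>*\<close>. As \<open>s v f = s u\<close>, this is the twist that restricts \<open>s v\<close> to \<open>s u\<close>.\<close>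

lemma incl_prod_right:
  assumes uv: "u \<preceq> v" and p: "p \<in> D (s\<^sup>\<star>)" and b: "b \<in> D u"
  shows "\<beta> s (p * (b \<lhd> \<upsilon> v (u\<^sup>\<star> * u))) \<lhd> \<omega> s v =
    \<beta> s (p * b) \<lhd> \<omega> s u \<lhd> \<upsilon> (s * v) ((s * u)\<^sup>\<star> * (s * u))"
proof -
  define f where "f = u\<^sup>\<star> * u"
  have f: "f \<in> idempotents" by (simp add: f_def idempotent_source)
  have vf: "v * f = u" by (simp add: f_def natural_leD[OF uv])
  then have svf: "s * v * f = s * u" by (simp add: mult.assoc)
  define x where "x = (p * b) \<lhd> \<upsilon> v f"
  have pb: "p * b \<in> D (v * f)" "p * b \<in> D (s\<^sup>\<star>)" using p b by (simp_all add: vf D_left D_right)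
  have x: "x \<in> D u" "x \<in> D (s\<^sup>\<star>)"
    using upsilon_right_mem[OF pb(1)] upsilon_right_mem'[OF pb] by (simp_all add: x_def vf)
  have xu: "x = p * (b \<lhd> \<upsilon> v f)" using b by (simp add: x_def upsilon_right_assoc vf)
  have "u \<preceq> v" by (rule uv)
  then have suv: "D (s * u) \<subseteq> D (s * v)" by (intro D_mono natural_le_mult_left)
  have bx: "\<beta> s x \<in> D (s * u)" using x by (intro beta_mem_mult)
  have z: "\<beta> s x \<lhd> \<omega> s v \<in> D (s * v * f)"
    using bx suv by (auto simp: svf intro!: omega_right_mem')
  have "\<beta> s (p * b) \<lhd> \<omega> s u = \<beta> s (x \<lhd> \<omega> v f) \<lhd> \<omega> s (v * f)"
    using pb by (simp add: x_def omega_cancel vf)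
  also have "\<dots> = \<beta> s x \<lhd> \<omega> s v \<lhd> \<omega> (s * v) f"
    using cocycle[of x s v f] x by (simp add: vf)
  also have "\<dots> = \<beta> s x \<lhd> \<omega> s v \<lhd> \<omega> (s * v) ((s * u)\<^sup>\<star> * (s * u))"
    using omega_right_cong[OF f z] by (simp add: svf)
  finally have "\<beta> s (p * b) \<lhd> \<omega> s u \<lhd> \<upsilon> (s * v) ((s * u)\<^sup>\<star> * (s * u)) = \<beta> s x \<lhd> \<omega> s v"
    using z by (simp add: omega_cancel natural_leD[OF natural_le_mult_left[OF uv]] svf)
  then show ?thesis by (simp add: xu f_def)
qed

text \<open>With \<open>e = s\<^sup>* s\<close>, the restricting twist \<open>\<omega>(t,e)\<^sup>*\<close> becomes a left multiplier by \<open>beta_restrict\<close>, so it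
  commutes with the right action of \<open>b\<close>; back on the right, it is moved past \<open>\<omega>(t,u)\<close> by
  \<open>omega_restrict_left\<close>.\<close>

lemma incl_prod_left:
  assumes st: "s \<preceq> t" and a: "a \<in> D s" and b: "b \<in> D u"
  shows "\<beta> t (\<gamma> t (a \<lhd> \<upsilon> t (s\<^sup>\<star> * s)) * b) \<lhd> \<omega> t u =
    \<beta> s (\<gamma> s a * b) \<lhd> \<omega> s u \<lhd> \<upsilon> (t * u) ((s * u)\<^sup>\<star> * (s * u))"
proof -
  define e where "e = s\<^sup>\<star> * s"
  have e: "e \<in> idempotents" by (simp add: e_def idempotent_source)
  have te: "t * e = s" by (simp add: e_def natural_leD[OF st])
  have De: "D e = D (s\<^sup>\<star>)" by (simp add: e_def D_source)
  have sub: "D (s\<^sup>\<star>) \<subseteq> D (t\<^sup>\<star>)" by (rule D_sinv_mono[OF st])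
  have restrict: "\<beta> s x \<lhd> \<upsilon> t e = \<upsilon> t e \<rhd> \<beta> t x" if x: "x \<in> D (s\<^sup>\<star>)" for x
  proof -
    have bx: "\<beta> t x \<in> D (t * e)" using x sub by (intro beta_mem_mult) (auto simp: De)
    have bs: "\<beta> s x \<in> D (t * e)" using x by (simp add: te beta_mem)
    have "\<upsilon> t e \<rhd> \<beta> t x = \<upsilon> t e \<rhd> (\<beta> t x \<lhd> \<omega> t e \<lhd> \<upsilon> t e)" using bx by (simp add: omega_cancel)
    also have "\<dots> = (\<upsilon> t e \<rhd> (\<beta> t x \<lhd> \<omega> t e)) \<lhd> \<upsilon> t e"
      using omega_right_mem[OF bx]
      by (intro multiplier_left_right_commute[OF ideal upsilon_mult ideal upsilon_mult, symmetric])
    also have "\<beta> t x \<lhd> \<omega> t e = \<omega> t e \<rhd> \<beta> s x" using beta_restrict[OF st x] by (simp add: e_def)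
    finally show ?thesis using bs by (simp add: omega_cancel)
  qed
  define p where "p = \<gamma> s a"
  have p: "p \<in> D (s\<^sup>\<star>)" "p \<in> D (t\<^sup>\<star>)" "\<beta> s p = a"
    using a sub by (auto simp: p_def beta_inv_mem beta_beta_inv)
  have bp: "\<beta> t p \<in> D (t * e)" using p by (intro beta_mem_mult) (auto simp: De)
  have pb: "p * b \<in> D (s\<^sup>\<star>)" "p * b \<in> D u" using p b by (simp_all add: D_left D_right)
  have bpb: "\<beta> s (p * b) \<in> D (s * u)" using pb by (rule beta_mem_mult)
  have D_su: "D (s * u) \<subseteq> D (t * e)" using D_mult_subset[of s u] by (simp add: te)
  define z where "z = \<beta> s (p * b) \<lhd> \<upsilon> t e"
  have z: "z \<in> D (s * u)" using bpb D_su by (auto simp: z_def intro!: upsilon_right_mem')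
  have "\<beta> t (\<gamma> t (a \<lhd> \<upsilon> t e) * b) = \<beta> t (\<gamma> t (\<upsilon> t e \<rhd> \<beta> t p) * b)"
    using restrict[OF p(1)] p(3) by simp
  also have "\<dots> = \<upsilon> t e \<rhd> \<beta> t (p * b)"
    using p by (simp add: beta_act_left_multiplier[OF upsilon_mult bp] beta_inv_beta)
  also have "\<dots> = z" using restrict[OF pb(1)] by (simp add: z_def)
  finally have 1: "\<beta> t (\<gamma> t (a \<lhd> \<upsilon> t e) * b) = z" .
  have h: "(s * u)\<^sup>\<star> * (s * u) = u\<^sup>\<star> * e * u" by (simp add: e_def sinv_mult mult.assoc)
  have tu: "D (s * u) \<subseteq> D (t * u)" by (intro D_mono natural_le_mult_right st)
  have "z \<lhd> \<omega> t u \<lhd> \<omega> (t * u) (u\<^sup>\<star> * e * u) = z \<lhd> \<omega> t e \<lhd> \<omega> s u"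
    using omega_restrict_left[OF e, of z t u] z te by (simp flip: mult.assoc)
  also have "z \<lhd> \<omega> t e = \<beta> s (p * b)" using bpb D_su by (auto simp: z_def omega_cancel)
  finally have 2: "\<beta> s (p * b) \<lhd> \<omega> s u = z \<lhd> \<omega> t u \<lhd> \<omega> (t * u) ((s * u)\<^sup>\<star> * (s * u))"
    by (simp only: h)
  have "z \<lhd> \<omega> t u \<in> D (s * u)" using z tu by (auto intro!: omega_right_mem')
  then have "z \<lhd> \<omega> t u = \<beta> s (p * b) \<lhd> \<omega> s u \<lhd> \<upsilon> (t * u) ((s * u)\<^sup>\<star> * (s * u))"
    unfolding 2 by (simp add: omega_cancel natural_leD[OF natural_le_mult_right[OF st]])
  then show ?thesis using 1 by (simp add: p_def e_def)
qed

text \<open>Let \<open>w\<close> be the left-hand side, \<open>p = \<beta>\<^sub>s\<^sup>-\<^sup>1(a\<^sup>*)\<close> and \<open>f = s s\<^sup>*\<close>. One cocycle identity gives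
  \<open>w \<omega>(t\<^sup>*,s) = p\<close>, another one \<open>\<omega>(t\<^sup>*,s) = \<omega>(t\<^sup>*,f) \<omega>(s\<^sup>*,s)\<close>.\<close>

lemma incl_star:
  assumes st: "s \<preceq> t" and a: "a \<in> D s"
  shows "\<gamma> t ((a \<lhd> \<upsilon> t (s\<^sup>\<star> * s))\<^sup>\<dagger>) \<lhd> \<upsilon> (t\<^sup>\<star>) t =
    \<gamma> s (a\<^sup>\<dagger>) \<lhd> \<upsilon> (s\<^sup>\<star>) s \<lhd> \<upsilon> (t\<^sup>\<star>) (s * s\<^sup>\<star>)"
proof -
  define e f where "e = s\<^sup>\<star> * s" and "f = s * s\<^sup>\<star>"
  have te: "t * e = s" by (simp add: e_def natural_leD[OF st])
  have tf: "t\<^sup>\<star> * f = s\<^sup>\<star>" and ts: "t\<^sup>\<star> * s = e"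
    using natural_le_sinv'[OF st] natural_le_source[OF st] by (simp_all add: e_def f_def)
  have fs: "f * s = s" by (simp add: f_def mult_sinv_mult)
  have De: "D e = D (s\<^sup>\<star>)" by (simp add: e_def D_source)
  have sub: "D (s\<^sup>\<star>) \<subseteq> D (t\<^sup>\<star>)" "D s \<subseteq> D t" using D_sinv_mono[OF st] D_mono[OF st] by auto
  define p where "p = \<gamma> s (a\<^sup>\<dagger>)"
  have p: "p \<in> D (s\<^sup>\<star>)" "p \<in> D (t\<^sup>\<star>)" "\<beta> s p = a\<^sup>\<dagger>" "p \<in> D (t\<^sup>\<star> * s)"
    using a sub by (auto simp: p_def ts De D_star beta_inv_mem beta_beta_inv)
  have bp: "\<beta> t p \<in> D (t * e)" using p by (intro beta_mem_mult) (auto simp: De)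
  define c where "c = \<beta> t p \<lhd> \<omega> t e"
  have c: "c \<in> D (t * e)" using bp by (simp add: c_def omega_right_mem)
  have c_eq: "c = (a \<lhd> \<upsilon> t e)\<^sup>\<dagger>"
    using beta_restrict[OF st p(1)] a p(3)
    by (simp add: c_def e_def upsilon_right_star natural_leD[OF st])
  define q where "q = \<gamma> t c"
  have q: "q \<in> D (t\<^sup>\<star>)" "q \<in> D e" "\<beta> t q = c"
    using beta_inv_mem_mult[OF c] c D_mult_subset[of t e] by (auto simp: q_def beta_beta_inv)
  define w where "w = q \<lhd> \<upsilon> (t\<^sup>\<star>) t"
  have w: "w \<in> D (t\<^sup>\<star> * t)" "w \<in> D (t\<^sup>\<star> * s)"
    using q by (auto simp: w_def ts D_source intro!: upsilon_right_mem' upsilon_right_mem)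
  have ws: "w \<lhd> \<omega> (t\<^sup>\<star>) s \<in> D (t\<^sup>\<star> * s)" "w \<lhd> \<omega> (t\<^sup>\<star>) s \<in> D (t\<^sup>\<star> * t)"
    using w by (auto intro!: omega_right_mem')
  \<comment> \<open>The cocycle identity for \<open>(t\<^sup>*, t, e)\<close>.\<close>
  have "\<beta> (t\<^sup>\<star>) c \<lhd> \<omega> (t\<^sup>\<star>) s = \<beta> (t\<^sup>\<star>) (\<beta> t p) \<lhd> \<omega> (t\<^sup>\<star>) t \<lhd> \<omega> (t\<^sup>\<star> * t) e"
    using cocycle[of "\<beta> t p" "t\<^sup>\<star>" t e] bp D_mult_subset[of t e] by (auto simp: c_def te)
  also have "\<dots> = (\<omega> (t\<^sup>\<star>) t \<rhd> p) \<lhd> \<omega> (t\<^sup>\<star> * t) e"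
    using p by (simp add: beta_beta_twist)
  also have "\<dots> = \<omega> (t\<^sup>\<star>) t \<rhd> p"
  proof (rule omega_idempotents_right)
    show "t\<^sup>\<star> * t \<in> idempotents" "e \<in> idempotents" by (simp_all add: e_def idempotent_source)
    show "\<omega> (t\<^sup>\<star>) t \<rhd> p \<in> D (t\<^sup>\<star> * t * e)"
      using p by (auto simp: mult.assoc te D_source intro!: omega_left_mem')
  qed
  also have "\<beta> (t\<^sup>\<star>) c = (\<omega> (t\<^sup>\<star>) t \<rhd> q) \<lhd> \<upsilon> (t\<^sup>\<star>) t"
  proof -
    have "c \<in> D ((t\<^sup>\<star>)\<^sup>\<star>)" using c D_mult_subset[of t e] by auto
    then have "\<beta> (t\<^sup>\<star>) c \<in> D (t\<^sup>\<star> * t)" by (simp add: D_source beta_mem)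
    then show ?thesis using beta_beta_twist[OF q(1)] q(3) by (metis omega_cancel(4))
  qed
  also have "\<dots> = \<omega> (t\<^sup>\<star>) t \<rhd> w"
    unfolding w_def using q
    by (intro multiplier_left_right_commute[OF ideal omega_mult ideal upsilon_mult]) (auto simp: D_source)
  also have "(\<omega> (t\<^sup>\<star>) t \<rhd> w) \<lhd> \<omega> (t\<^sup>\<star>) s = \<omega> (t\<^sup>\<star>) t \<rhd> (w \<lhd> \<omega> (t\<^sup>\<star>) s)"
    using w by (intro multiplier_left_right_commute[OF ideal omega_mult ideal omega_mult])
  finally have wp: "w \<lhd> \<omega> (t\<^sup>\<star>) s = p"
    using ws p by (metis D_source omega_cancel(1))
  \<comment> \<open>The cocycle identity for \<open>(t\<^sup>*, s s\<^sup>*, s)\<close>.\<close>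
  have "w \<lhd> \<omega> (t\<^sup>\<star>) s = w \<lhd> \<omega> (t\<^sup>\<star>) f \<lhd> \<omega> (s\<^sup>\<star>) s"
  proof -
    have x: "\<gamma> (t\<^sup>\<star>) w \<in> D s" "\<gamma> (t\<^sup>\<star>) w \<in> D t" "\<beta> (t\<^sup>\<star>) (\<gamma> (t\<^sup>\<star>) w) = w"
      using beta_inv_mem_mult[OF w(2)] w D_mult_subset[of "t\<^sup>\<star>" s] by (auto intro: beta_beta_inv)
    have "\<gamma> (t\<^sup>\<star>) w \<lhd> \<omega> f s = \<gamma> (t\<^sup>\<star>) w" using x by (simp add: f_def omega_range_right)
    then show ?thesis
      using cocycle[of "\<gamma> (t\<^sup>\<star>) w" "t\<^sup>\<star>" f s] x by (simp add: fs tf)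
  qed
  moreover have "w \<in> D (t\<^sup>\<star> * f)" "w \<lhd> \<omega> (t\<^sup>\<star>) f \<in> D (s\<^sup>\<star> * s)"
    using w omega_right_mem[of w "t\<^sup>\<star>" f] by (auto simp: tf ts De D_source)
  ultimately have "p \<lhd> \<upsilon> (s\<^sup>\<star>) s \<lhd> \<upsilon> (t\<^sup>\<star>) f = w"
    by (simp add: omega_cancel flip: wp)
  then show ?thesis by (simp add: w_def q_def c_eq p_def e_def f_def)
qed

end


section \<open>The Fell bundle\<close>

lemma tw_fibre_simps [simp]:
  "vcarrier (tw_fibre D s) = D s \<times> {s}"
  "vzero (tw_fibre D s) = (0, s)"
  "vadd (tw_fibre D s) x y = (fst x + fst y, s)"
  "vscale (tw_fibre D s) c x = (c *\<^sub>C fst x, s)"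
  "vnorm (tw_fibre D s) x = norm (fst x)"
  by (simp_all add: tw_fibre_def)

lemma vdist_tw_fibre [simp]: "vdist (tw_fibre D s) x y = norm (fst x - fst y)"
  by (simp add: vdist_def scaleC_minus)

lemma complex_banach_space_closed_ideal:
  assumes "closed_ideal (D s)"
  shows "complex_banach_space (tw_fibre D s)"
proof
  note id = closed_idealD[OF assms]
  fix X :: "nat \<Rightarrow> 'a \<times> 'b"
  assume X: "\<And>n. X n \<in> vcarrier (tw_fibre D s)"
    and C: "\<forall>\<epsilon>>0. \<exists>N. \<forall>m\<ge>N. \<forall>n\<ge>N. vdist (tw_fibre D s) (X m) (X n) < \<epsilon>"
  have X': "fst (X n) \<in> D s" for n using X[of n] by (cases "X n") auto
  have "Cauchy (\<lambda>n. fst (X n))" using C by (simp add: Cauchy_def dist_norm)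
  then obtain x where x: "(\<lambda>n. fst (X n)) \<longlonglongrightarrow> x" by (auto simp: Cauchy_convergent_iff convergent_def)
  then have "x \<in> D s" using id(1) X' by (metis closed_sequential_limits)
  moreover have "(\<lambda>n. norm (fst (X n) - x)) \<longlonglongrightarrow> 0"
    using x by (simp add: LIM_zero tendsto_norm_zero)
  ultimately show "\<exists>x\<in>vcarrier (tw_fibre D s). (\<lambda>n. vdist (tw_fibre D s) (X n) x) \<longlonglongrightarrow> 0"
    by (intro bexI[of _ "(x, s)"]) auto
qed (use closed_idealD[OF assms] in
  \<open>auto simp: scaleC_add_right scaleC_add_left scaleC_scaleC norm_scaleC scaleC_minus
     intro: norm_triangle_ineq\<close>)

context twisted_action
begin

abbreviation "mul \<equiv> tw_mult D \<beta> \<omega>"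
abbreviation "invol \<equiv> tw_star D \<beta> \<omega>"
abbreviation "incl \<equiv> tw_incl D \<omega>"

lemma tw_star_eq [simp]: "invol (a, s) = (\<gamma> s (a\<^sup>\<dagger>) \<lhd> \<upsilon> (s\<^sup>\<star>) s, s\<^sup>\<star>)"
  by (simp add: upsilon_def)

lemma tw_incl_eq [simp]: "incl t s (a, r) = (a \<lhd> \<upsilon> t (s\<^sup>\<star> * s), t)"
  by (simp add: tw_incl_def upsilon_def)

declare tw_star.simps [simp del]

lemma omega_right_linear:
  shows omega_right_add: "x \<in> D (s * t) \<Longrightarrow> y \<in> D (s * t) \<Longrightarrow> (x + y) \<lhd> \<omega> s t = (x \<lhd> \<omega> s t) + (y \<lhd> \<omega> s t)"
    and omega_right_scaleC: "x \<in> D (s * t) \<Longrightarrow> (c *\<^sub>C x) \<lhd> \<omega> s t = c *\<^sub>C (x \<lhd> \<omega> s t)"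
    and upsilon_right_add: "x \<in> D (s * t) \<Longrightarrow> y \<in> D (s * t) \<Longrightarrow> (x + y) \<lhd> \<upsilon> s t = (x \<lhd> \<upsilon> s t) + (y \<lhd> \<upsilon> s t)"
    and upsilon_right_scaleC: "x \<in> D (s * t) \<Longrightarrow> (c *\<^sub>C x) \<lhd> \<upsilon> s t = c *\<^sub>C (x \<lhd> \<upsilon> s t)"
  using multiplier_right_linear[OF omega_mult] multiplier_right_linear[OF upsilon_mult]
  unfolding linear_on_def by blast+

lemma act_mem:
  assumes "a \<in> D s" "b \<in> D t"
  shows "\<gamma> s a * b \<in> D (s\<^sup>\<star>)" "\<gamma> s a * b \<in> D t" "\<beta> s (\<gamma> s a * b) \<in> D (s * t)"
proof -
  show 1: "\<gamma> s a * b \<in> D (s\<^sup>\<star>)" "\<gamma> s a * b \<in> D t"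
    using assms by (auto intro: D_left D_right beta_inv_mem)
  then show "\<beta> s (\<gamma> s a * b) \<in> D (s * t)" by (rule beta_mem_mult)
qed

lemma prod_mem: "a \<in> D s \<Longrightarrow> b \<in> D t \<Longrightarrow> \<beta> s (\<gamma> s a * b) \<lhd> \<omega> s t \<in> D (s * t)"
  by (intro omega_right_mem act_mem)

lemma beta_inv_mem_source: "a \<in> D s \<Longrightarrow> \<gamma> s a \<in> D (s\<^sup>\<star> * s)"
  by (simp add: D_source beta_inv_mem)

lemma star_mem: "a \<in> D s \<Longrightarrow> \<gamma> s (a\<^sup>\<dagger>) \<lhd> \<upsilon> (s\<^sup>\<star>) s \<in> D (s\<^sup>\<star>)"
  using upsilon_right_mem[OF beta_inv_mem_source[OF D_star]] by (simp add: D_source)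

lemma norm_star_eq: "a \<in> D s \<Longrightarrow> norm (\<gamma> s (a\<^sup>\<dagger>) \<lhd> \<upsilon> (s\<^sup>\<star>) s) = norm a"
  by (simp add: norm_upsilon beta_inv_mem_source D_star norm_beta_inv norm_star)

lemma incl_mem: "s \<preceq> t \<Longrightarrow> a \<in> D s \<Longrightarrow> a \<lhd> \<upsilon> t (s\<^sup>\<star> * s) \<in> D s"
  using upsilon_right_mem[of a t "s\<^sup>\<star> * s"] by (simp add: natural_leD)

lemma prod_assoc:
  assumes a: "a \<in> D r" and b: "b \<in> D s" and c: "c \<in> D t"
  shows "mul (mul (a, r) (b, s)) (c, t) = mul (a, r) (mul (b, s) (c, t))"
proof -
  define p q where "p = \<gamma> r a" and "q = \<gamma> s b"
  have p: "p \<in> D (r\<^sup>\<star>)" and q: "q \<in> D (s\<^sup>\<star>)" and b_eq: "\<beta> s q = b"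
    using a b by (simp_all add: p_def q_def beta_inv_mem beta_beta_inv)
  have qc: "\<beta> s (q * c) \<in> D (s * t)" using act_mem[OF b c] by (simp add: q_def)
  then have x: "p * \<beta> s (q * c) \<in> D (r\<^sup>\<star>)" "p * \<beta> s (q * c) \<in> D (s * t)"
    using p by (auto intro: D_left D_right)
  have "\<beta> (r * s) (\<gamma> (r * s) (\<beta> r (p * b) \<lhd> \<omega> r s) * c) \<lhd> \<omega> (r * s) t =
      \<beta> r (p * \<beta> s (q * c)) \<lhd> \<omega> r s \<lhd> \<omega> (r * s) t"
    using beta_act_comp[OF p q] by (simp add: b_eq)
  also have "\<dots> = \<beta> r ((p * \<beta> s (q * c)) \<lhd> \<omega> s t) \<lhd> \<omega> r (s * t)" using cocycle[of _ r s t] x by simp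
  finally show ?thesis using qc by (simp add: p_def q_def omega_right_assoc mult.assoc)
qed

text \<open>In the inner product the twists of the multiplication and of the involution cancel. The C*-identity,
  positivity and regularity of the bundle all follow from this formula.\<close>

lemma star_prod:
  assumes a: "a \<in> D s" and c: "c \<in> D s"
  shows "mul (invol (a, s)) (c, s) = (\<gamma> s (a\<^sup>\<dagger> * c), s\<^sup>\<star> * s)"
proof -
  have m: "a\<^sup>\<dagger> \<in> D s" "a\<^sup>\<dagger> \<in> D (s * s\<^sup>\<star>)" "a\<^sup>\<dagger> * c \<in> D s"
    using a c by (auto simp: D_range intro: D_star D_right)
  have "\<beta> (s\<^sup>\<star>) (\<gamma> (s\<^sup>\<star>) (\<gamma> s (a\<^sup>\<dagger>) \<lhd> \<upsilon> (s\<^sup>\<star>) s) * c) = \<beta> (s\<^sup>\<star>) (\<upsilon> s (s\<^sup>\<star>) \<rhd> (a\<^sup>\<dagger> * c))"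
    using m by (simp add: beta_inv_upsilon upsilon_left_assoc)
  also have "\<dots> = \<gamma> s (a\<^sup>\<dagger> * c) \<lhd> \<upsilon> (s\<^sup>\<star>) s" using m by (simp add: beta_upsilon)
  finally show ?thesis using m by (simp add: omega_cancel beta_inv_mem_source)
qed

lemma star_prod_idempotent:
  assumes e: "e \<in> idempotents" and a: "a \<in> D e" and c: "c \<in> D e"
  shows "mul (invol (a, e)) (c, e) = (a\<^sup>\<dagger> * c, e)"
proof -
  have ee: "e\<^sup>\<star> = e" "e * e = e" using e idempotent_sinv by (auto simp: idempotents_iff)
  have "a\<^sup>\<dagger> * c \<in> D e" using c by (rule D_left)
  then have "\<gamma> e (a\<^sup>\<dagger> * c) = a\<^sup>\<dagger> * c"
    using beta_inv_beta[of "a\<^sup>\<dagger> * c" e] beta_idempotent[OF e] ee by simp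
  then show ?thesis using star_prod[OF a c] ee by simp
qed

lemma star_star_bundle:
  assumes a: "a \<in> D s"
  shows "invol (invol (a, s)) = (a, s)"
proof -
  have m: "a\<^sup>\<dagger> \<in> D s" "a\<^sup>\<dagger> \<in> D (s * s\<^sup>\<star>)" "a \<in> D (s * s\<^sup>\<star>)" using a by (auto simp: D_range intro: D_star)
  have "\<gamma> (s\<^sup>\<star>) ((\<gamma> s (a\<^sup>\<dagger>) \<lhd> \<upsilon> (s\<^sup>\<star>) s)\<^sup>\<dagger>) = (\<upsilon> s (s\<^sup>\<star>) \<rhd> a\<^sup>\<dagger>)\<^sup>\<dagger>"
    using m beta_inv_star[OF star_mem[OF a]] by (simp add: beta_inv_upsilon)
  also have "\<dots> = a \<lhd> \<omega> s (s\<^sup>\<star>)" using m by (simp add: upsilon_left_star star_star)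
  finally show ?thesis using m by (simp add: omega_cancel)
qed

lemma star_mult_bundle:
  assumes a: "a \<in> D s" and b: "b \<in> D t"
  shows "invol (mul (a, s) (b, t)) = mul (invol (b, t)) (invol (a, s))"
proof -
  define p y where "p = \<gamma> s a" and "y = p * b"
  have y: "y \<in> D (s\<^sup>\<star>)" "y \<in> D t" and ys: "y\<^sup>\<dagger> = b\<^sup>\<dagger> * p\<^sup>\<dagger>"
    using act_mem[OF a b] by (simp_all add: y_def p_def star_mult)
  have b': "b\<^sup>\<dagger> \<in> D t" "b\<^sup>\<dagger> \<in> D (t * t\<^sup>\<star>)" and p': "p\<^sup>\<dagger> \<in> D (s\<^sup>\<star> * s)"
    using a b by (auto simp: D_range p_def intro: D_star beta_inv_mem_source)
  have yw: "y\<^sup>\<dagger> \<lhd> \<upsilon> (s\<^sup>\<star>) s = b\<^sup>\<dagger> * (p\<^sup>\<dagger> \<lhd> \<upsilon> (s\<^sup>\<star>) s)"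
    using p' by (simp add: ys upsilon_right_assoc)
  then have yt: "y\<^sup>\<dagger> \<lhd> \<upsilon> (s\<^sup>\<star>) s \<in> D t" using b'(1) by (simp add: D_right)
  have "\<beta> (t\<^sup>\<star>) (\<gamma> (t\<^sup>\<star>) (\<gamma> t (b\<^sup>\<dagger>) \<lhd> \<upsilon> (t\<^sup>\<star>) t) * (p\<^sup>\<dagger> \<lhd> \<upsilon> (s\<^sup>\<star>) s))
      = \<beta> (t\<^sup>\<star>) (\<upsilon> t (t\<^sup>\<star>) \<rhd> (y\<^sup>\<dagger> \<lhd> \<upsilon> (s\<^sup>\<star>) s))"
    using b' by (simp add: beta_inv_upsilon upsilon_left_assoc yw)
  also have "\<dots> = \<gamma> t (y\<^sup>\<dagger> \<lhd> \<upsilon> (s\<^sup>\<star>) s) \<lhd> \<upsilon> (t\<^sup>\<star>) t" by (rule beta_upsilon[OF yt])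
  finally show ?thesis
    using twist_star_mult[OF y] beta_inv_star[OF a] by (simp add: p_def y_def sinv_mult)
qed

lemma incl_trans:
  assumes "r \<preceq> s" "s \<preceq> t" "a \<in> D r"
  shows "incl t r (a, r) = incl t s (incl s r (a, r))"
  using upsilon_trans[OF assms] by simp

lemma incl_mult:
  assumes st: "s \<preceq> t" and uv: "u \<preceq> v" and a: "a \<in> D s" and b: "b \<in> D u"
  shows "mul (incl t s (a, s)) (incl v u (b, u)) = incl (t * v) (s * u) (mul (a, s) (b, u))"
proof -
  define b' where "b' = b \<lhd> \<upsilon> v (u\<^sup>\<star> * u)"
  have b': "b' \<in> D v" using incl_mem[OF uv b] D_mono[OF uv] by (auto simp: b'_def)
  have "mul (incl t s (a, s)) (b', v) = incl (t * v) (s * v) (mul (a, s) (b', v))"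
    using incl_prod_left[OF st a b'] by simp
  also have "mul (a, s) (b', v) = incl (s * v) (s * u) (mul (a, s) (b, u))"
    using incl_prod_right[OF uv beta_inv_mem[OF a] b] by (simp add: b'_def)
  also have "incl (t * v) (s * v) \<dots> = incl (t * v) (s * u) (mul (a, s) (b, u))"
    using incl_trans[OF natural_le_mult_left[OF uv] natural_le_mult_right[OF st] prod_mem[OF a b]]
    by simp
  finally show ?thesis by (simp add: b'_def)
qed

lemma twisted_fell_bundle: "fell_bundle (tw_fibre D) mul invol incl"
proof (rule fell_bundle.intro, goal_cases)
  case (1 s)
  show ?case by (rule complex_banach_space_closed_ideal) (rule ideal)
next
  case (2 s t)
  then show ?case by auto
next
  case (3 s t)
  then show ?case
    using incl_mem[OF 3] D_mono[OF 3]
    by (auto simp: isometric_linear_def upsilon_right_add upsilon_right_scaleC norm_upsilon natural_leD)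
next
  case (4 a s b t)
  then show ?case by (auto simp: prod_mem)
next
  case (5 a s a' b t)
  then show ?case
    by (auto simp: beta_inv_add distrib_right beta_add act_mem omega_right_add)
next
  case (6 a s b t b')
  then show ?case
    by (auto simp: distrib_left beta_add act_mem omega_right_add)
next
  case (7 a s b t c)
  then show ?case
    by (auto simp: beta_inv_scaleC mult_scaleC_left beta_scaleC act_mem omega_right_scaleC)
next
  case (8 a s b t c)
  then show ?case
    by (auto simp: mult_scaleC_right beta_scaleC act_mem omega_right_scaleC)
next
  case (9 a r b s d t)
  then obtain x y z where "x \<in> D r" "y \<in> D s" "z \<in> D t" "a = (x, r)" "b = (y, s)" "d = (z, t)"
    by auto
  then show ?case by (simp only: prod_assoc)
next
  case (10 a s b t)
  then obtain x y where xy: "x \<in> D s" "y \<in> D t" "a = (x, s)" "b = (y, t)" by auto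
  have "norm (\<gamma> s x * y) \<le> norm x * norm y"
    using norm_mult_ineq[of "\<gamma> s x" y] xy by (simp add: norm_beta_inv)
  then show ?case using xy act_mem[OF xy(1,2)] by (simp add: norm_omega norm_beta)
next
  case (11 a s)
  then show ?case by (auto simp: star_mem)
next
  case (12 a s b)
  then show ?case
    by (auto simp: star_add beta_inv_add D_star upsilon_right_add beta_inv_mem_source)
next
  case (13 a s c)
  then show ?case
    by (auto simp: star_scaleC beta_inv_scaleC D_star upsilon_right_scaleC beta_inv_mem_source)
next
  case (14 a s)
  then show ?case using star_star_bundle by auto
next
  case (15 a s)
  then show ?case by (auto simp: norm_star_eq)
next
  case (16 a s b t)
  then obtain x y where "x \<in> D s" "y \<in> D t" "a = (x, s)" "b = (y, t)" by auto
  then show ?case by (simp only: star_mult_bundle)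
next
  case (17 a s)
  then obtain x where x: "x \<in> D s" "a = (x, s)" by auto
  have "norm (\<gamma> s (x\<^sup>\<dagger> * x)) = (norm x)\<^sup>2"
    using x(1) by (simp add: norm_beta_inv D_left cstar_identity)
  then show ?case using star_prod[OF x(1,1)] by (simp add: x(2) del: tw_star_eq tw_mult.simps)
next
  case (18 a s)
  then obtain x where x: "x \<in> D s" "a = (x, s)" by auto
  have "mul (invol a) a = mul (invol (\<gamma> s x, s\<^sup>\<star> * s)) (\<gamma> s x, s\<^sup>\<star> * s)"
    using star_prod[OF x(1,1)]
      star_prod_idempotent[OF idempotent_source beta_inv_mem_source beta_inv_mem_source, OF x(1,1)]
    by (simp add: x D_star beta_inv_mult beta_inv_star del: tw_star_eq tw_mult.simps)
  moreover have "(\<gamma> s x, s\<^sup>\<star> * s) \<in> vcarrier (tw_fibre D (s\<^sup>\<star> * s))"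
    using x by (simp add: beta_inv_mem_source)
  ultimately show ?case by (rule bexI)
next
  case (19 r s t a)
  then show ?case using incl_trans by auto
next
  case (20 s t u v a b)
  then obtain x y where "x \<in> D s" "y \<in> D u" "a = (x, s)" "b = (y, u)" by auto
  with 20 show ?case by (simp only: incl_mult)
next
  case (21 s t a)
  then show ?case using incl_star by auto
qed

text \<open>Every element of the fibre at \<open>s t\<close> is \<open>\<beta>\<^sub>s(x) \<omega>(s,t)\<close> with \<open>x\<close> in both \<open>D\<^sub>s\<^sub>*\<close> and \<open>D\<^sub>t\<close>, and
  is approximated by the single products \<open>\<beta>\<^sub>s(u x) \<omega>(s,t)\<close>, \<open>u \<in> D\<^sub>s\<^sub>*\<close>.\<close>

lemma twisted_saturated: "saturated_fell_bundle (tw_fibre D) mul invol incl"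
proof (intro saturated_fell_bundle.intro saturated_fell_bundle_axioms.intro twisted_fell_bundle)
  fix s t
  let ?A = "tw_fibre D (s * t)"
  let ?P = "{mul a b |a b. a \<in> vcarrier (tw_fibre D s) \<and> b \<in> vcarrier (tw_fibre D t)}"
  have sub: "?P \<subseteq> vcarrier ?A" using prod_mem by auto
  have "vsubspace ?A (vcarrier ?A)"
    by (auto simp: vsubspace_def D_zero D_add D_scaleC)
  then have "vspan ?A ?P \<subseteq> vcarrier ?A" unfolding vspan_def using sub by (rule hull_minimal[rotated])
  moreover have "\<exists>y\<in>vspan ?A ?P. vdist ?A z y < \<epsilon>" if "z \<in> vcarrier ?A" "\<epsilon> > 0" for z \<epsilon>
  proof -
    obtain y where y: "y \<in> D (s * t)" "z = (y, s * t)" using \<open>z \<in> vcarrier ?A\<close> by auto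
    have yw: "y \<lhd> \<upsilon> s t \<in> D (s * t)" using y(1) by (rule upsilon_right_mem)
    define x where "x = \<gamma> s (y \<lhd> \<upsilon> s t)"
    have x: "x \<in> D (s\<^sup>\<star>)" "x \<in> D t" using beta_inv_mem_mult[OF yw] by (simp_all add: x_def)
    have "y \<lhd> \<upsilon> s t \<in> D s" using yw D_mult_subset by blast
    then have y_eq: "y = \<beta> s x \<lhd> \<omega> s t" using y(1) by (simp add: x_def beta_beta_inv omega_cancel)
    obtain u where u: "u \<in> D (s\<^sup>\<star>)" "norm (x - u * x) < \<epsilon>"
      using ex_approximate_left_unit[OF ideal x(1) \<open>\<epsilon> > 0\<close>] by metis
    define y' where "y' = \<beta> s (u * x) \<lhd> \<omega> s t"
    have ux: "u * x \<in> D (s\<^sup>\<star>)" "u * x \<in> D t" using x by (auto intro: D_left)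
    have d: "x - u * x \<in> D (s\<^sup>\<star>)" "x - u * x \<in> D t"
      using x ux closed_ideal_diff[OF ideal] by auto
    have "\<beta> s (x - u * x) + \<beta> s (u * x) = \<beta> s x"
      using beta_add[OF d(1) ux(1)] by simp
    then have "y = (\<beta> s (x - u * x) \<lhd> \<omega> s t) + y'"
      using omega_right_add[OF beta_mem_mult[OF d] beta_mem_mult[OF ux]] by (simp add: y_eq y'_def)
    then have "norm (y - y') = norm (x - u * x)"
      using d by (simp add: norm_omega beta_mem_mult norm_beta)
    moreover have "(y', s * t) = mul (\<beta> s u, s) (x, t)" using u by (simp add: y'_def beta_inv_beta)
    then have "(y', s * t) \<in> ?P" using beta_mem[OF u(1)] x(2) by auto
    then have "(y', s * t) \<in> vspan ?A ?P" unfolding vspan_def by (rule hull_inc)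
    ultimately show ?thesis using u(2) y(2) by force
  qed
  ultimately show "vdense ?A (vspan ?A ?P)" by (simp add: vdense_def)
qed

text \<open>The unitary \<open>D\<^sub>s\<^sub>*\<^sub>s \<rightarrow> D\<^sub>s\<close> is \<open>\<beta>\<^sub>s\<close> itself, with adjoint \<open>\<beta>\<^sub>s\<^sup>-\<^sup>1\<close>.\<close>

lemma twisted_regular: "regular_fell_bundle (tw_fibre D) mul invol incl"
proof (intro regular_fell_bundle.intro regular_fell_bundle_axioms.intro twisted_saturated exI conjI)
  fix s
  let ?u = "\<lambda>x. (\<beta> s (fst x), s)" and ?v = "\<lambda>y. (\<gamma> s (fst y), s\<^sup>\<star> * s)"
  show "adjointable_with (vcarrier (tw_fibre D (s\<^sup>\<star> * s))) (\<lambda>x y. mul (invol x) y)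
      (vcarrier (tw_fibre D s)) (\<lambda>x y. mul (invol x) y) ?u ?v"
    unfolding adjointable_with_def
  proof (intro conjI ballI)
    show "?u \<in> vcarrier (tw_fibre D (s\<^sup>\<star> * s)) \<rightarrow> vcarrier (tw_fibre D s)"
      by (auto simp: D_source beta_mem)
    show "?v \<in> vcarrier (tw_fibre D s) \<rightarrow> vcarrier (tw_fibre D (s\<^sup>\<star> * s))"
      by (auto simp: beta_inv_mem_source)
    fix x y assume "x \<in> vcarrier (tw_fibre D (s\<^sup>\<star> * s))" "y \<in> vcarrier (tw_fibre D s)"
    then obtain a b where ab: "a \<in> D (s\<^sup>\<star> * s)" "b \<in> D s" "x = (a, s\<^sup>\<star> * s)" "y = (b, s)" by auto
    then have a: "a \<in> D (s\<^sup>\<star>)" by (simp add: D_source)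
    have "\<gamma> s ((\<beta> s a)\<^sup>\<dagger> * b) = a\<^sup>\<dagger> * \<gamma> s b"
      using a ab(2) by (simp add: beta_inv_mult D_star beta_mem beta_inv_star beta_inv_beta)
    then show "mul (invol (?u x)) y = mul (invol x) (?v y)"
      using star_prod[OF beta_mem[OF a] ab(2)]
        star_prod_idempotent[OF idempotent_source ab(1) beta_inv_mem_source[OF ab(2)]]
      by (simp add: ab(3,4) del: tw_star_eq tw_mult.simps)
  qed
  show "\<forall>x\<in>vcarrier (tw_fibre D (s\<^sup>\<star> * s)). ?v (?u x) = x" by (auto simp: D_source beta_inv_beta)
  show "\<forall>y\<in>vcarrier (tw_fibre D s). ?u (?v y) = y" by (auto simp: beta_beta_inv)
qed

end

theorem theorem4p12:
  fixes D :: "'s::inverse_semigroup \<Rightarrow> 'b::cstar_algebra set"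
    and \<beta> :: "'s \<Rightarrow> 'b \<Rightarrow> 'b"
    and \<omega> :: "'s \<Rightarrow> 's \<Rightarrow> 'b multiplier"
  assumes "twisted_action D \<beta> \<omega>"
  shows "regular_fell_bundle (tw_fibre D) (tw_mult D \<beta> \<omega>) (tw_star D \<beta> \<omega>) (tw_incl D \<omega>)"
  using assms by (rule twisted_action.twisted_regular)

end
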